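(* $\chi(\mathrm{S\text{-}Forb}(C(2,3))\cap\mathcal S)=4$; that is, the maximum chromatic number of a strongly connected digraph containing no subdivision of $C(2,3)$ as a subdigraph is $4$.
   Context: Digraphs are finite, without loops or parallel arcs (two opposite arcs between the same two vertices are allowed). The chromatic number $\chi(D)$ of a digraph $D$ is the chromatic number of its underlying undirected graph. The chromatic number $\chi(\mathcal D)$ of a class $\mathcal D$ of digraphs is the smallest $m$ such that $\chi(D)\le m$ for all $D\in\mathcal D$, or $+\infty$ if no such $m$ exists. $\mathcal S$ is the class of strongly connected digraphs. $C(k,\ell)$ is the oriented cycle with two blocks of lengths $k$ and $\ell$: the union of two internally disjoint directed paths with the same initial vertex and the same terminal vertex (distinct from the initial vertex), one of length $k$ and one of length $\ell$. A subdivision of a digraph $F$ is obtained from $F$ by replacing each arc $uv$ by a directed $(u,v)$-path of length at least $1$, these paths being pairwise internally disjoint with new internal vertices. $\mathrm{S\text{-}Forb}(F)$ is the class of digraphs containing no subdivision of $F$ as a subdigraph. *)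

theory Defs
  imports "Graph_Theory.Graph_Theory" "HOL-Library.Extended_Nat" "HOL-Library.Infinite_Typeclass"
begin

text \<open>
  Digraphs are represented by \<^typ>\<open>'a pair_pre_digraph\<close> together with the locale predicate
  \<^const>\<open>pair_digraph\<close>: finite, loopless, with a set of ordered pairs as arcs, so that
  parallel arcs are excluded while opposite arcs are allowed. Classes of digraphs are sets over
  one vertex type \<open>'a\<close>; when \<open>'a\<close> is infinite, every finite digraph has an isomorphic copy in it.
\<close>

definition proper_colouring :: "'a pair_pre_digraph \<Rightarrow> nat \<Rightarrow> ('a \<Rightarrow> nat) \<Rightarrow> bool" where
  "proper_colouring G k c \<longleftrightarrow>
     c ` pverts G \<subseteq> {..<k} \<and> (\<forall>(u, v) \<in> parcs G. c u \<noteq> c v)"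

text \<open>
  Undirected graphs are symmetric digraphs, as in the library; \<^const>\<open>mk_symmetric\<close> yields the
  underlying undirected graph.
\<close>

definition graph_chromatic_number :: "'a pair_pre_digraph \<Rightarrow> nat" where
  "graph_chromatic_number G = (LEAST k. \<exists>c. proper_colouring G k c)"

definition chromatic_number :: "'a pair_pre_digraph \<Rightarrow> nat" where
  "chromatic_number D = graph_chromatic_number (mk_symmetric (with_proj D))"

text \<open>In \<^typ>\<open>enat\<close> the infimum of the empty set is \<open>\<infinity>\<close>.\<close>

definition class_chromatic_number :: "'a pair_pre_digraph set \<Rightarrow> enat" where
  "class_chromatic_number \<D> = Inf {enat m | m. \<forall>D \<in> \<D>. chromatic_number D \<le> m}"

definition strong_digraphs :: "'a pair_pre_digraph set" where
  "strong_digraphs = {D. pair_digraph D \<and> strongly_connected (with_proj D)}"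

text \<open>
  The directed paths \<open>0, 1, \<dots>, k\<close> and \<open>0, k + 1, \<dots>, k + l - 1, k\<close>, of lengths \<open>k\<close> and \<open>l\<close>.
  Meaningful for \<open>k, l \<ge> 1\<close> and \<open>k + l \<ge> 3\<close>; for \<open>k = l = 1\<close> the two arcs would be parallel.
\<close>

definition two_block_cycle :: "nat \<Rightarrow> nat \<Rightarrow> nat pair_pre_digraph" where
  "two_block_cycle k l =
     \<lparr> pverts = {..<k + l},
       parcs = set (vwalk_arcs [0..<Suc k]) \<union> set (vwalk_arcs (0 # [Suc k..<k + l] @ [k])) \<rparr>"

text \<open>
  \<open>H\<close> is, up to the names of its vertices, a subdivision of \<open>F\<close>: \<open>\<phi>\<close> gives the branch vertices and
  \<open>P a\<close> is the path replacing the arc \<open>a\<close>. The library's \<^const>\<open>subdivision\<close> cannot be used,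
  since it is restricted to bidirected digraphs.
\<close>

definition is_subdivision_of :: "'a pair_pre_digraph \<Rightarrow> 'f pair_pre_digraph \<Rightarrow> bool" where
  "is_subdivision_of H F \<longleftrightarrow>
     (\<exists>\<phi> P. inj_on \<phi> (pverts F) \<and>
        (\<forall>a \<in> parcs F.
           pre_digraph.apath (with_proj H) (\<phi> (fst a)) (P a) (\<phi> (snd a)) \<and>
           length (P a) \<ge> 1 \<and>
           set (pre_digraph.inner_verts (with_proj H) (P a)) \<inter> \<phi> ` pverts F = {}) \<and>
        (\<forall>a \<in> parcs F. \<forall>b \<in> parcs F. a \<noteq> b \<longrightarrow>
           set (pre_digraph.inner_verts (with_proj H) (P a)) \<inter>
           set (pre_digraph.inner_verts (with_proj H) (P b)) = {}) \<and>
        pverts H = \<phi> ` pverts F \<union>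
          (\<Union>a \<in> parcs F. set (pre_digraph.inner_verts (with_proj H) (P a))) \<and>
        parcs H = (\<Union>a \<in> parcs F. set (P a)))"

definition S_Forb :: "'f pair_pre_digraph \<Rightarrow> 'a pair_pre_digraph set" where
  "S_Forb F =
     {D. pair_digraph D \<and>
         \<not> (\<exists>H. subgraph (with_proj H) (with_proj D) \<and> is_subdivision_of H F)}"

end

theory Submission
  imports Defs
begin

text \<open>
Four colours are needed because the complete digraph on four vertices is strong, while a subdivision
of \<open>C(2,3)\<close> has at least five vertices. The work is to show that they suffice. A subdivision of
\<open>C(2,3)\<close> amounts to a theta: two internally disjoint directed paths with common ends, one with at
least one and the other with at least two inner vertices. So let \<open>D\<close> be strong without a theta, and
use induction on the number of vertices.

If all directed cycles of \<open>D\<close> have length at most 4, then Bondy's theorem applies: a strong digraph is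
\<open>k\<close>-colourable if no directed cycle is longer than \<open>k\<close> (\<open>strong_colourable_if_cycles_short\<close>). It is
proved here by a potential argument. Put integers of at most 1 on the arcs, as small as possible such that
every directed cycle has sum at least 1. By minimality every arc then lies on a cycle of sum exactly 1.
Give an arc with integer \<open>b\<close> the weight \<open>1 - k b\<close>. No directed cycle has positive weight, so the
maximal weight of a path from a root to \<open>v\<close> is a potential \<open>f v\<close>. Along an arc \<open>uv\<close> it increases by at
least \<open>1 - k b\<close>; going back from \<open>v\<close> to \<open>u\<close> along the cycle of sum 1 shows that it increases by at most
\<open>k - 1 - k b\<close>. Hence \<open>f\<close> modulo \<open>k\<close> is a proper colouring.

If \<open>D\<close> has a cut vertex, then colour the two sides by induction and permute the colours of one of them.

Otherwise let \<open>C\<close> be a longest directed cycle, of length \<open>n \<ge> 5\<close>. A directed path through vertices off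
\<open>C\<close> from a vertex of \<open>C\<close> to another one is at most as long as the segment of \<open>C\<close> that it bypasses. As
the two form no theta, it has just one inner vertex \<open>x\<close> and replaces just one vertex of \<open>C\<close> (\<open>ear\<close>). If \<open>C\<close> misses
some vertex, then such an \<open>x\<close> exists, since otherwise what hangs off \<open>C\<close> is attached to it
at a cut vertex (\<open>exists_short_ear\<close>); and all neighbours of \<open>x\<close> are the two ends of its ear, since
otherwise \<open>x\<close> itself is a cut vertex or there is a theta (\<open>short_ear_neighbours\<close>). So \<open>x\<close> has at most two
neighbours, and \<open>D - x\<close> is strong because walks can follow \<open>C\<close> instead of passing through \<open>x\<close>. Colour \<open>D - x\<close> by
induction, then \<open>x\<close>.

There remains the case that \<open>C\<close> is Hamiltonian. Two crossing chords yield a theta unless they join the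
positions \<open>i - 1\<close> to \<open>i + 1\<close> and \<open>i\<close> to \<open>i + 2\<close> for some \<open>i\<close> (\<open>crossing\<close>). The vertices at such
positions \<open>i\<close> are pairwise nonadjacent and can all get the fourth colour (\<open>skip_independent\<close>).
Without them no two chords cross, and three colours are enough as for an outerplanar graph
(\<open>noncrossing_3_colourable\<close>).
\<close>

section \<open>Directed paths and colourings\<close>

text \<open>
Paths are lists of vertices and digraphs are bare sets of arcs, because the induction passes to ever
smaller digraphs, and a path in one of them is the same list as in the larger ones.
\<close>

definition dipath :: "('a \<times> 'a) set \<Rightarrow> 'a list \<Rightarrow> bool" where
  "dipath A xs \<longleftrightarrow> distinct xs \<and> successively (\<lambda>u v. (u, v) \<in> A) xs"

lemma dipath_append:
  "dipath A (xs @ ys) \<longleftrightarrow> dipath A xs \<and> dipath A ys \<and> set xs \<inter> set ys = {} \<and>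
     (xs = [] \<or> ys = [] \<or> (last xs, hd ys) \<in> A)"
  unfolding dipath_def by (auto simp: successively_append_iff)

lemma dipath_simps [simp]:
  "dipath A []" "dipath A [x]"
  "dipath A (x # y # zs) \<longleftrightarrow> (x, y) \<in> A \<and> x \<noteq> y \<and> x \<notin> set zs \<and> dipath A (y # zs)"
  by (auto simp: dipath_def)

lemma dipath_Cons:
  "dipath A (x # xs) \<longleftrightarrow> dipath A xs \<and> x \<notin> set xs \<and> (xs = [] \<or> (x, hd xs) \<in> A)"
  by (cases xs) (auto simp: dipath_def)

lemma dipath_mono: "dipath A xs \<Longrightarrow> A \<subseteq> B \<Longrightarrow> dipath B xs"
  unfolding dipath_def by (auto elim: successively_mono)

text \<open>
Append the arcs one by one; when a vertex comes up again, cut the path back to its first occurrence.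
\<close>

lemma rtrancl_imp_dipath:
  assumes "(u, v) \<in> (A \<inter> W \<times> W)\<^sup>*" "u \<in> W"
  shows "\<exists>xs. xs \<noteq> [] \<and> dipath A xs \<and> hd xs = u \<and> last xs = v \<and> set xs \<subseteq> W"
  using assms(1)
proof induction
  case base
  show ?case using assms(2) by (intro exI[of _ "[u]"]) auto
next
  case (step v w)
  then obtain xs where xs: "xs \<noteq> []" "dipath A xs" "hd xs = u" "last xs = v" "set xs \<subseteq> W" by blast
  show ?case
  proof (cases "w \<in> set xs")
    case True
    then obtain ys zs where "xs = ys @ w # zs" by (meson split_list)
    with xs show ?thesis
      by (intro exI[of _ "ys @ [w]"]) (auto simp: dipath_append hd_append)
  next
    case False
    with xs step.hyps show ?thesis
      by (intro exI[of _ "xs @ [w]"]) (auto simp: dipath_append)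
  qed
qed

text \<open>
The counterpart of \<^const>\<open>proper_colouring\<close> for bare arc sets. As the condition on an arc is
symmetric, the arcs need not be symmetrised first.
\<close>

definition colouring :: "nat \<Rightarrow> 'a set \<Rightarrow> ('a \<times> 'a) set \<Rightarrow> ('a \<Rightarrow> nat) \<Rightarrow> bool" where
  "colouring k V A c \<longleftrightarrow> c ` V \<subseteq> {..<k} \<and> (\<forall>(u, v)\<in>A. c u \<noteq> c v)"

lemma colouringI:
  "(\<And>v. v \<in> V \<Longrightarrow> c v < k) \<Longrightarrow> (\<And>u v. (u, v) \<in> A \<Longrightarrow> c u \<noteq> c v) \<Longrightarrow> colouring k V A c"
  by (auto simp: colouring_def)

lemma colouring_neq: "colouring k V A c \<Longrightarrow> (u, v) \<in> A \<Longrightarrow> c u \<noteq> c v"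
  by (auto simp: colouring_def)

section \<open>Short cycles: colouring by a potential\<close>

fun walk_weight :: "('a \<times> 'a \<Rightarrow> int) \<Rightarrow> 'a list \<Rightarrow> int" where
  "walk_weight w (x # y # zs) = w (x, y) + walk_weight w (y # zs)"
| "walk_weight w _ = 0"

lemma walk_weight_append:
  "xs \<noteq> [] \<Longrightarrow> ys \<noteq> [] \<Longrightarrow>
   walk_weight w (xs @ ys) = walk_weight w xs + w (last xs, hd ys) + walk_weight w ys"
proof (induction w xs rule: walk_weight.induct)
  case ("2_2" w v)
  then show ?case by (cases ys) auto
qed auto

lemma walk_weight_fun_upd:
  "\<not> (\<exists>ps qs. xs = ps @ u # v # qs) \<Longrightarrow> walk_weight (w((u, v) := t)) xs = walk_weight w xs"
proof (induction w xs rule: walk_weight.induct)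
  case (1 w x y zs)
  have "(x, y) \<noteq> (u, v)" using 1(2) by (metis append_Nil prod.inject)
  then have "(w((u, v) := t)) (x, y) = w (x, y)" by (rule fun_upd_other)
  moreover have "walk_weight (w((u, v) := t)) (y # zs) = walk_weight w (y # zs)"
    using 1(2) by (intro 1(1)) (metis append_Cons)
  ultimately show ?case by (simp only: walk_weight.simps)
qed auto

lemma walk_weight_affine:
  "xs \<noteq> [] \<Longrightarrow> walk_weight (\<lambda>e. 1 - k * b e) xs = int (length xs) - 1 - k * walk_weight b xs"
  by (induction b xs rule: walk_weight.induct) (auto simp: algebra_simps)

lemma walk_weight_le_length:
  "dipath A xs \<Longrightarrow> (\<And>e. e \<in> A \<Longrightarrow> b e \<le> 1) \<Longrightarrow> walk_weight b xs \<le> int (length xs - 1)"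
proof (induction b xs rule: walk_weight.induct)
  case (1 w x y zs)
  then show ?case by (fastforce dest: 1(3)[of "(x,y)"])
qed auto

text \<open>
A directed cycle is an arc \<open>e\<close> with a path from its head back to its tail. This representation lists
each cycle once for every choice of the closing arc; conditions on all cycles are therefore invariant
under rotation by \<open>cycle_through_rotate\<close>. The number of vertices of the path is the length of the cycle.
\<close>

definition cycle_through :: "('a \<times> 'a) set \<Rightarrow> 'a \<times> 'a \<Rightarrow> 'a list \<Rightarrow> bool" where
  "cycle_through A e xs \<longleftrightarrow> e \<in> A \<and> xs \<noteq> [] \<and> dipath A xs \<and> hd xs = snd e \<and> last xs = fst e"

text \<open>
The integers on the arcs in the potential argument. The upper bound 1 limits what the other arcs of a
cycle can contribute, so that every value is bounded below and minimal functions exist.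
\<close>

definition heavy :: "('a \<times> 'a) set \<Rightarrow> ('a \<times> 'a \<Rightarrow> int) \<Rightarrow> bool" where
  "heavy A b \<longleftrightarrow> (\<forall>e\<in>A. b e \<le> 1) \<and> (\<forall>e xs. cycle_through A e xs \<longrightarrow> 1 \<le> walk_weight b xs + b e)"

lemma heavyD: "heavy A b \<Longrightarrow> cycle_through A e xs \<Longrightarrow> 1 \<le> walk_weight b xs + b e"
  unfolding heavy_def by blast

lemma cycle_through_rotate:
  assumes "cycle_through A (u, v) (ps @ u' # v' # qs)"
  shows "cycle_through A (u', v') ((v' # qs) @ ps @ [u'])"
    and "walk_weight b ((v' # qs) @ ps @ [u']) + b (u', v') = walk_weight b (ps @ u' # v' # qs) + b (u, v)"
proof -
  have "ps @ u' # v' # qs = (ps @ [u']) @ (v' # qs)" by simp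
  moreover from assms have "hd (ps @ [u']) = v" "last (v' # qs) = u"
    by (auto simp: cycle_through_def hd_append split: if_splits)
  moreover have "dipath A ((ps @ [u']) @ (v' # qs))" "(u, v) \<in> A"
    using assms by (auto simp: cycle_through_def)
  ultimately show "cycle_through A (u', v') ((v' # qs) @ ps @ [u'])"
    unfolding cycle_through_def by (simp only: dipath_append) auto
  have "walk_weight b ((ps @ [u']) @ (v' # qs)) = walk_weight b (ps @ [u']) + b (u', v') + walk_weight b (v' # qs)"
    by (subst walk_weight_append) auto
  moreover have "walk_weight b ((v' # qs) @ (ps @ [u'])) = walk_weight b (v' # qs) + b (u, v) + walk_weight b (ps @ [u'])"
    using \<open>hd (ps @ [u']) = v\<close> \<open>last (v' # qs) = u\<close> by (subst walk_weight_append) auto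
  ultimately show "walk_weight b ((v' # qs) @ ps @ [u']) + b (u', v') = walk_weight b (ps @ u' # v' # qs) + b (u, v)"
    by simp
qed

text \<open>
Take \<open>b\<close> of minimal total value. If some arc were on no cycle of sum exactly 1, then its
value could be lowered by 1. The values are bounded below by \<open>2 - k\<close>: an arc lies on a cycle, whose at most
\<open>k - 1\<close> other arcs contribute at most 1 each.
\<close>

lemma heavy_tight:
  fixes A :: "('a \<times> 'a) set"
  assumes fin: "finite A"
    and cyc: "\<And>e. e \<in> A \<Longrightarrow> \<exists>xs. cycle_through A e xs"
    and len: "\<And>e xs. cycle_through A e xs \<Longrightarrow> length xs \<le> k"
  obtains b where "heavy A b" and "\<And>e. e \<in> A \<Longrightarrow> \<exists>xs. cycle_through A e xs \<and> walk_weight b xs + b e = 1"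
proof -
  have lower: "b e \<ge> 2 - int k" if b: "heavy A b" and e: "e \<in> A" for b e
  proof -
    obtain xs where xs: "cycle_through A e xs" using cyc e by blast
    have "walk_weight b xs \<le> int (length xs - 1)"
      by (rule walk_weight_le_length[of A]) (use xs b in \<open>auto simp: cycle_through_def heavy_def\<close>)
    moreover have "1 \<le> walk_weight b xs + b e" using heavyD[OF b xs] .
    moreover have "xs \<noteq> []" using xs by (simp add: cycle_through_def)
    ultimately show ?thesis using len[OF xs] by (cases xs) auto
  qed
  \<comment> \<open>Adding \<open>k\<close> makes all values positive, so that the total can be measured in the natural numbers.\<close>
  define m where "m b = (\<Sum>e\<in>A. nat (b e + int k))" for b :: "'a \<times> 'a \<Rightarrow> int"
  have "walk_weight (\<lambda>e. 1) xs \<ge> 0" for xs :: "'a list"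
    by (induction "\<lambda>e :: 'a \<times> 'a. 1 :: int" xs rule: walk_weight.induct) auto
  then have "heavy A (\<lambda>e. 1)" by (simp add: heavy_def)
  then obtain b where b: "heavy A b" and min: "\<And>b'. heavy A b' \<Longrightarrow> m b \<le> m b'"
    using ex_has_least_nat[of "heavy A" _ m] by blast
  have "\<exists>xs. cycle_through A e xs \<and> walk_weight b xs + b e = 1" if e: "e \<in> A" for e
  proof (rule ccontr)
    assume none: "\<not> ?thesis"
    obtain u v where uv: "e = (u, v)" by (cases e)
    define b' where "b' = b((u, v) := b (u, v) - 1)"
    \<comment> \<open>A sum that is at least 1 and is not 1 leaves room for lowering \<open>b e\<close>.\<close>
    have slack: "2 \<le> walk_weight b xs + b e" if "cycle_through A e xs" for xs
      using none that heavyD[OF b that] by (smt (verit))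
    \<comment> \<open>On a cycle closed by \<open>e\<close> the remaining path does not use \<open>e\<close> again.\<close>
    have own: "1 \<le> walk_weight b' xs + b' e" if "cycle_through A e xs" for xs
    proof -
      have "\<not> (\<exists>ps qs. xs = ps @ u # v # qs)"
        using that unfolding cycle_through_def uv dipath_def by (fastforce simp: hd_append split: if_splits)
      then have "walk_weight b' xs = walk_weight b xs" unfolding b'_def by (rule walk_weight_fun_upd)
      then show ?thesis using slack[OF that] by (simp add: b'_def uv)
    qed
    have "1 \<le> walk_weight b' xs + b' e'" if c: "cycle_through A e' xs" for e' xs
    proof (cases "e' = e")
      case True
      then show ?thesis using own c by simp
    next
      case False
      show ?thesis
      proof (cases "\<exists>ps qs. xs = ps @ u # v # qs")
        case True
        then obtain ps qs where xs: "xs = ps @ u # v # qs" by blast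
        obtain u' v' where e': "e' = (u', v')" by (cases e')
        show ?thesis
          using own[unfolded uv, OF cycle_through_rotate(1)[OF c[unfolded xs e']]]
            cycle_through_rotate(2)[OF c[unfolded xs e'], of b'] by (simp add: xs e')
      next
        case no: False
        then have "walk_weight b' xs = walk_weight b xs" unfolding b'_def by (rule walk_weight_fun_upd)
        then show ?thesis using heavyD[OF b c] False by (simp add: b'_def uv)
      qed
    qed
    moreover have "b' e' \<le> 1" if "e' \<in> A" for e' using b that e uv by (force simp: b'_def heavy_def)
    ultimately have "heavy A b'" by (simp add: heavy_def)
    moreover have "m b' < m b"
      unfolding m_def
    proof (rule sum_strict_mono_ex1[OF fin])
      show "\<forall>e\<in>A. nat (b' e + int k) \<le> nat (b e + int k)" by (auto simp: b'_def)
      show "\<exists>e\<in>A. nat (b' e + int k) < nat (b e + int k)"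
        using e lower[OF b e] by (intro bexI[of _ e]) (auto simp: b'_def uv)
    qed
    ultimately show False using min by fastforce
  qed
  with b that show ?thesis by blast
qed

lemma finite_dipaths: "finite V \<Longrightarrow> finite {xs. dipath A xs \<and> set xs \<subseteq> V}"
  by (rule finite_subset[OF _ finite_subset_distinct]) (auto simp: dipath_def)

text \<open>
The potential of \<open>v\<close> is the maximal weight of a path from a fixed root to \<open>v\<close>. When an arc \<open>uv\<close> cannot extend
an optimal path to \<open>u\<close> because that path already visits \<open>v\<close>, then it closes a cycle, whose weight is not
positive and which may be dropped.
\<close>

lemma longest_path_potential:
  assumes V: "finite V" "A \<subseteq> V \<times> V" and strong: "\<And>u v. u \<in> V \<Longrightarrow> v \<in> V \<Longrightarrow> (u, v) \<in> A\<^sup>*"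
    and nonpos: "\<And>e xs. cycle_through A e xs \<Longrightarrow> walk_weight w xs + w e \<le> 0"
  obtains f :: "'a \<Rightarrow> int" where "\<And>u v. (u, v) \<in> A \<Longrightarrow> f u + w (u, v) \<le> f v"
proof (cases "A = {}")
  case True
  then show ?thesis using that by blast
next
  case False
  then obtain r where r: "r \<in> V" using V by auto
  define P where "P v = {xs. xs \<noteq> [] \<and> dipath A xs \<and> set xs \<subseteq> V \<and> hd xs = r \<and> last xs = v}" for v
  define f where "f v = Max (walk_weight w ` P v)" for v
  have finP: "finite (P v)" for v
    by (rule finite_subset[OF _ finite_dipaths[OF V(1), of A]]) (auto simp: P_def)
  have le: "walk_weight w xs \<le> f v" if "xs \<in> P v" for xs v
    unfolding f_def using that finP by (intro Max_ge) auto
  have "A = A \<inter> V \<times> V" using V by auto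
  then have neP: "P v \<noteq> {}" if "v \<in> V" for v
    using rtrancl_imp_dipath[of r v A V] strong[OF r that] r by (auto simp: P_def)
  have "f u + w (u, v) \<le> f v" if uv: "(u, v) \<in> A" for u v
  proof -
    have "u \<in> V" "v \<in> V" using uv V by auto
    then have "f u \<in> walk_weight w ` P u" unfolding f_def using finP neP by (intro Max_in) auto
    then obtain xs where xs: "xs \<in> P u" "f u = walk_weight w xs" by auto
    show ?thesis
    proof (cases "v \<in> set xs")
      case False
      then have "xs @ [v] \<in> P v" using xs uv \<open>v \<in> V\<close> by (auto simp: P_def dipath_append)
      from le[OF this] show ?thesis using xs by (auto simp: P_def walk_weight_append)
    next
      case True
      then obtain ps qs where s: "xs = ps @ v # qs" by (meson split_list)
      have c: "cycle_through A (u, v) (v # qs)" using xs uv s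
        by (auto simp: P_def cycle_through_def dipath_append)
      show ?thesis
      proof (cases "ps = []")
        case True
        then have "[v] \<in> P v" using xs s \<open>v \<in> V\<close> by (auto simp: P_def)
        from le[OF this] show ?thesis using xs s True nonpos[OF c] by auto
      next
        case False
        then have "ps @ [v] \<in> P v" using xs s by (auto simp: P_def dipath_append)
        from le[OF this] show ?thesis using xs s False nonpos[OF c] by (auto simp: walk_weight_append)
      qed
    qed
  qed
  then show ?thesis using that by blast
qed

lemma potential_along_walk:
  fixes f :: "'a \<Rightarrow> int"
  assumes "\<And>u v. (u, v) \<in> A \<Longrightarrow> f u + w (u, v) \<le> f v"
  shows "xs \<noteq> [] \<Longrightarrow> dipath A xs \<Longrightarrow> f (hd xs) + walk_weight w xs \<le> f (last xs)"
proof (induction xs rule: induct_list012)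
  case (3 x y zs)
  then show ?case using assms[of x y] by auto
qed auto

text \<open>
Bondy's theorem. For an arc \<open>uv\<close> on a cycle of sum 1 the two potential inequalities, for the arc itself and for
the rest of the cycle, confine \<open>f v - f u + k b\<close> to the range from 1 to \<open>k - 1\<close>, so \<open>f u\<close> and \<open>f v\<close> are not
congruent modulo \<open>k\<close>. The cycle has at least two vertices as there are no loops; this
gives the upper end of the range.
\<close>

theorem strong_colourable_if_cycles_short:
  assumes V: "finite V" "A \<subseteq> V \<times> V" and irr: "\<And>v. (v, v) \<notin> A"
    and strong: "\<And>u v. u \<in> V \<Longrightarrow> v \<in> V \<Longrightarrow> (u, v) \<in> A\<^sup>*"
    and len: "\<And>e xs. cycle_through A e xs \<Longrightarrow> length xs \<le> k" and k: "k > 0"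
  shows "\<exists>c. colouring k V A c"
proof -
  have AV: "A = A \<inter> V \<times> V" using V by auto
  have cyc: "\<exists>xs. cycle_through A e xs" if "e \<in> A" for e
    using rtrancl_imp_dipath[of "snd e" "fst e" A V] strong[of "snd e" "fst e"] that V AV
    by (force simp: cycle_through_def)
  obtain b where b: "heavy A b"
    and tight: "\<And>e. e \<in> A \<Longrightarrow> \<exists>xs. cycle_through A e xs \<and> walk_weight b xs + b e = 1"
    using heavy_tight[of A k] cyc len finite_subset[OF V(2)] V(1) by blast
  define w where "w e = 1 - int k * b e" for e
  have w: "walk_weight w xs + w e = int (length xs) - int k * (walk_weight b xs + b e)"
    if "xs \<noteq> []" for xs e
    using walk_weight_affine[OF that, of "int k" b] by (simp add: w_def[abs_def] algebra_simps)
  have "walk_weight w xs + w e \<le> 0" if c: "cycle_through A e xs" for e xs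
  proof -
    have "int k * 1 \<le> int k * (walk_weight b xs + b e)"
      using heavyD[OF b c] by (intro mult_left_mono) auto
    then show ?thesis using w[of xs e] len[OF c] c by (auto simp: cycle_through_def)
  qed
  then obtain f where f: "\<And>u v. (u, v) \<in> A \<Longrightarrow> f u + w (u, v) \<le> f v"
    using longest_path_potential[OF V strong, of w] by blast
  define c where "c v = nat (f v mod int k)" for v
  have "c u \<noteq> c v" if uv: "(u, v) \<in> A" for u v
  proof
    assume eq: "c u = c v"
    obtain xs where xs: "cycle_through A (u, v) xs" and t: "walk_weight b xs + b (u, v) = 1"
      using tight uv by blast
    have ne: "xs \<noteq> []" and "length xs \<noteq> 1"
      using xs irr by (auto simp: cycle_through_def length_Suc_conv)
    then have l: "length xs \<ge> 2" by (cases xs rule: remdups_adj.cases) auto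
    have "f v + walk_weight w xs \<le> f u"
      using potential_along_walk[where A = A and f = f and w = w and xs = xs, OF f] xs
      by (auto simp: cycle_through_def)
    then have "f v - f u + int k * b (u, v) \<le> int k - 1" using w[OF ne, of "(u, v)"] t l
      by (simp add: w_def)
    moreover have "f v - f u + int k * b (u, v) \<ge> 1" using f[OF uv] by (simp add: w_def)
    moreover have "f u mod int k = f v mod int k" using eq k by (simp add: c_def nat_eq_iff)
    then have "int k dvd f v - f u + int k * b (u, v)"
      by (metis dvd_add dvd_triv_left mod_eq_dvd_iff)
    ultimately show False using zdvd_imp_le[of "int k" "f v - f u + int k * b (u, v)"] by linarith
  qed
  moreover have "c v < k" for v using k by (simp add: c_def nat_less_iff)
  ultimately show ?thesis by (intro exI[of _ c] colouringI)
qed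

section \<open>Thetas\<close>

text \<open>
The excluded thetas are the subdivisions of \<open>C(2,3)\<close>: the two paths have lengths at least 2 and at
least 3, and \<open>ps\<close> and \<open>qs\<close> are their inner vertices.
\<close>

definition theta_free :: "('a \<times> 'a) set \<Rightarrow> bool" where
  "theta_free A \<longleftrightarrow> \<not> (\<exists>u v ps qs. dipath A (u # ps @ [v]) \<and> dipath A (u # qs @ [v]) \<and>
     set ps \<inter> set qs = {} \<and> 1 \<le> length ps \<and> 2 \<le> length qs)"

lemma theta_freeD:
  "theta_free A \<Longrightarrow> dipath A (u # ps @ [v]) \<Longrightarrow> dipath A (u # qs @ [v]) \<Longrightarrow>
   set ps \<inter> set qs = {} \<Longrightarrow> 1 \<le> length ps \<Longrightarrow> 2 \<le> length qs \<Longrightarrow> False"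
  unfolding theta_free_def by blast

lemma theta_free_mono: "theta_free B \<Longrightarrow> A \<subseteq> B \<Longrightarrow> theta_free A"
  unfolding theta_free_def by (meson dipath_mono)

section \<open>Longest cycles and their ears\<close>

text \<open>
A directed cycle of length \<open>n\<close>, traversed periodically by the integers. Cyclic order then becomes
the order of the integers within a window of \<open>n\<close> consecutive positions, and no rotations of lists are needed.
\<close>

locale dicycle =
  fixes V :: "'a set" and A :: "('a \<times> 'a) set" and n :: int and g :: "int \<Rightarrow> 'a"
  assumes arcs: "A \<subseteq> V \<times> V" and loopless: "(v, v) \<notin> A"
    and theta_free: "theta_free A"
    and step: "(g i, g (i + 1)) \<in> A"
    and g_eq: "g i = g j \<longleftrightarrow> i mod n = j mod n"
    and n: "5 \<le> n"
begin

definition "C = range g"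

lemma C_subset: "C \<subseteq> V"
  using step arcs by (auto simp: C_def)

lemma g_period [simp]: "g (i + n) = g i" "g (i - n) = g i"
  by (simp_all add: g_eq)

lemma g_neq: "i < j \<Longrightarrow> j < i + n \<Longrightarrow> g i \<noteq> g j"
proof
  assume *: "i < j" "j < i + n" "g i = g j"
  then have "n dvd j - i" by (metis g_eq mod_eq_dvd_iff)
  then show False using * zdvd_imp_le[of n "j - i"] by auto
qed

lemma g_inj: "inj_on g {i..<i + n}"
proof (rule inj_onI)
  fix x y assume *: "x \<in> {i..<i + n}" "y \<in> {i..<i + n}" "g x = g y"
  show "x = y" using g_neq[of x y] g_neq[of y x] * by force
qed

lemma C_window: "x \<in> C \<Longrightarrow> \<exists>j. i \<le> j \<and> j < i + n \<and> x = g j"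
proof -
  assume "x \<in> C"
  then obtain m where m: "x = g m" by (auto simp: C_def)
  have "x = g (i + (m - i) mod n)" by (simp add: m g_eq mod_simps)
  then show ?thesis using n by (intro exI[of _ "i + (m - i) mod n"]) auto
qed

text \<open>
Chords and arcs of the cycle alike, so that a path which uses both is a single list of positions.
\<close>

definition jump :: "int \<Rightarrow> int \<Rightarrow> bool" where "jump i j \<longleftrightarrow> (g i, g j) \<in> A"

lemma jump_step [simp]: "jump i (i + 1)" "jump (i - 1) i"
  using step[of i] step[of "i - 1"] by (auto simp: jump_def)

lemma jump_period [simp]:
  "jump (i + n) j = jump i j" "jump i (j + n) = jump i j" "jump (i - n) j = jump i j"
  by (auto simp: jump_def)

lemma hd_upto: "i \<le> j \<Longrightarrow> hd [i..j] = i"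
  by (simp add: upto_rec1)

lemma last_upto: "i \<le> j \<Longrightarrow> last [i..j] = j"
  by (simp add: upto_rec2)

lemma successively_jump_upto [simp]: "successively jump [i..j]"
proof (induction i j rule: upto.induct)
  case (1 i j)
  then show ?case
    by (cases "i \<le> j"; cases "i = j") (auto simp: upto_rec1 successively_Cons hd_upto)
qed

lemma dipath_map:
  assumes "distinct js" "successively jump js" "set js \<subseteq> {i..<i + n}"
  shows "dipath A (map g js)"
  using assms inj_on_subset[OF g_inj assms(3)]
  by (auto simp: dipath_def distinct_map successively_map jump_def)

definition seg :: "int \<Rightarrow> int \<Rightarrow> 'a list" where "seg i j = map g [i..j]"

lemma set_seg [simp]: "set (seg i j) = g ` {i..j}"
  by (simp add: seg_def)

lemma length_seg [simp]: "length (seg i j) = nat (j - i + 1)"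
  by (simp add: seg_def)

lemma seg_Nil_iff [simp]: "seg i j = [] \<longleftrightarrow> j < i"
  by (simp add: seg_def)

lemma hd_seg [simp]: "i \<le> j \<Longrightarrow> hd (seg i j) = g i"
  by (simp add: seg_def upto_rec1)

lemma last_seg [simp]: "i \<le> j \<Longrightarrow> last (seg i j) = g j"
  by (simp add: seg_def upto_rec2)

lemma dipath_seg: "j < i + n \<Longrightarrow> dipath A (seg i j)"
  unfolding seg_def by (rule dipath_map[of _ i]) auto

lemma g_notin: "i < j \<Longrightarrow> k < i + n \<Longrightarrow> g i \<notin> g ` {j..k}"
proof
  assume *: "i < j" "k < i + n" "g i \<in> g ` {j..k}"
  then obtain x where "g i = g x" "j \<le> x" "x \<le> k" by auto
  then show False using g_neq[of i x] * by auto
qed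

text \<open>
Rerouting the cycle along \<open>ps\<close> gives a directed cycle, so \<open>ps\<close> has at most as many vertices as the bypassed
segment has inner ones. If the segment had two inner vertices or more, then it would form a theta with
\<open>ps\<close>. So both have exactly one.
\<close>

lemma ear:
  assumes longest: "\<And>e xs. cycle_through A e xs \<Longrightarrow> int (length xs) \<le> n"
    and ij: "i < j" "j < i + n" and ps: "dipath A ps" "ps \<noteq> []" "set ps \<inter> C = {}"
    and ends: "(g i, hd ps) \<in> A" "(last ps, g j) \<in> A"
  shows "length ps = 1 \<and> j = i + 2"
proof -
  have sub: "g ` S \<subseteq> C" for S by (auto simp: C_def)
  have "cycle_through A (g (i + n - 1), g i) (g i # ps @ seg j (i + n - 1))"
    unfolding cycle_through_def
    using step[of "i + n - 1"] ij ps ends dipath_seg[of "i + n - 1" j] sub g_notin[of i j "i + n - 1"]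
    by (auto simp: dipath_append dipath_Cons hd_append C_def)
  from longest[OF this] have len: "int (length ps) \<le> j - i - 1" using ij by auto
  have "dipath A (g i # ps @ [g j])" using ps ends ij g_neq[of i j]
    by (auto simp: dipath_append dipath_Cons hd_append C_def)
  moreover have "dipath A (g i # seg (i + 1) (j - 1) @ [g j])"
  proof -
    have "[i..j] = i # [i + 1..j - 1] @ [j]"
      using ij upto_rec1[of i j] upto_rec2[of "i + 1" j] by simp
    then have "seg i j = g i # seg (i + 1) (j - 1) @ [g j]" by (simp add: seg_def)
    then show ?thesis using dipath_seg[of j i] ij by simp
  qed
  moreover have "set ps \<inter> set (seg (i + 1) (j - 1)) = {}" using ps by (auto simp: C_def)
  moreover have "length ps \<ge> 1" using ps by (cases ps) auto
  ultimately have "\<not> 2 \<le> length (seg (i + 1) (j - 1))" using theta_freeD[OF theta_free] by blast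
  then show ?thesis using len \<open>length ps \<ge> 1\<close> by auto
qed

end

section \<open>Colouring along a Hamiltonian cycle\<close>

text \<open>
This is the 3-colourability of outerplanar graphs. Some vertex has at most two neighbours, and the rest
is coloured by induction. To find it, take a shortest edge \<open>ij\<close> with a vertex strictly between its
ends, and the first vertex \<open>v\<close> after \<open>i\<close>. An edge from \<open>v\<close> cannot cross \<open>ij\<close>, so it stays between
\<open>i\<close> and \<open>j\<close>; to the right it can only reach the next vertex \<open>y\<close>, for otherwise it would be a
shorter edge with \<open>y\<close> between its ends. So the neighbours of \<open>v\<close> are among \<open>i\<close> and \<open>y\<close>. If there is
no such edge \<open>ij\<close>, then the first vertex of all can only be joined to the second one.
\<close>

lemma noncrossing_3_colourable:
  fixes I :: "int set"
  assumes "finite I" "E \<subseteq> I \<times> I" "sym E" "irrefl E"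
    and "\<And>i k j l. i < k \<Longrightarrow> k < j \<Longrightarrow> j < l \<Longrightarrow> (i, j) \<in> E \<Longrightarrow> (k, l) \<in> E \<Longrightarrow> False"
  shows "\<exists>c. colouring 3 I E c"
  using assms
proof (induction "card I" arbitrary: I E)
  case 0
  then show ?case by (auto simp: colouring_def)
next
  case (Suc n)
  have "\<exists>v\<in>I. \<exists>x y. \<forall>u. (v, u) \<in> E \<longrightarrow> u = x \<or> u = y"
  proof (cases "\<exists>i j k. (i, j) \<in> E \<and> i < k \<and> k < j \<and> k \<in> I")
    case False
    have ne: "I \<noteq> {}" using Suc by auto
    define v where "v = Min I"
    have v: "v \<in> I" "\<And>u. u \<in> I \<Longrightarrow> v \<le> u" using ne Suc by (auto simp: v_def)
    show ?thesis
    proof (cases "I = {v}")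
      case True
      then show ?thesis using Suc.prems by (auto simp: irrefl_def)
    next
      case c2: False
      then have ne': "I - {v} \<noteq> {}" using v by auto
      define y where "y = Min (I - {v})"
      have y: "y \<in> I - {v}" "\<And>u. u \<in> I - {v} \<Longrightarrow> y \<le> u"
        using Min_in[of "I - {v}"] Min_le[of "I - {v}"] ne' Suc by (auto simp: y_def)
      have "u = y" if "(v, u) \<in> E" for u
      proof -
        have "u \<in> I - {v}" using that Suc.prems by (auto simp: irrefl_def)
        then have "y \<le> u" "\<not> (v < y \<and> y < u)" using y False that by auto
        then show ?thesis using v y by force
      qed
      then show ?thesis using v by blast
    qed
  next
    case True
    \<comment> \<open>The edges with a vertex strictly between their ends.\<close>
    define wide where "wide p \<longleftrightarrow> p \<in> E \<and> (\<exists>k\<in>I. fst p < k \<and> k < snd p)" for p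
    from True obtain i0 j0 where "wide (i0, j0)" by (auto simp: wide_def)
    from ex_has_least_nat[of wide, OF this, of "\<lambda>p. nat (snd p - fst p)"]
    obtain p where "wide p" and p: "\<And>q. wide q \<Longrightarrow> nat (snd p - fst p) \<le> nat (snd q - fst q)"
      by blast
    then obtain k where ij: "(fst p, snd p) \<in> E" "fst p < k" "k < snd p" "k \<in> I" by (auto simp: wide_def)
    define i j where "i = fst p" and "j = snd p"
    note ij = ij[folded i_def j_def]
    have min: "j - i \<le> j' - i'" if "(i', j') \<in> E" "i' < k'" "k' < j'" "k' \<in> I" for i' j' k'
    proof -
      have "nat (j - i) \<le> nat (j' - i')"
        using p[of "(i', j')"] that by (auto simp: wide_def i_def j_def)
      then show ?thesis using that by linarith
    qed
    define K where "K = {u \<in> I. i < u}"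
    define v where "v = Min K"
    have "finite K" "k \<in> K" using Suc ij by (auto simp: K_def)
    then have "v \<in> K" unfolding v_def by (intro Min_in) auto
    then have v: "v \<in> I" "i < v" "v \<le> k" "\<And>u. u \<in> I \<Longrightarrow> i < u \<Longrightarrow> v \<le> u"
      using Min_le[OF \<open>finite K\<close>, folded v_def] \<open>k \<in> K\<close> by (auto simp: K_def)
    define L where "L = {u \<in> I. v < u}"
    define y where "y = Min L"
    have "finite L" "j \<in> L" using Suc ij v by (auto simp: L_def)
    then have "y \<in> L" unfolding y_def by (intro Min_in) auto
    then have y: "y \<in> I" "v < y" "\<And>u. u \<in> I \<Longrightarrow> v < u \<Longrightarrow> y \<le> u"
      using Min_le[OF \<open>finite L\<close>, folded y_def] by (auto simp: L_def)
    have "u = i \<or> u = y" if e: "(v, u) \<in> E" for u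
    proof (rule ccontr)
      assume n: "\<not> ?thesis"
      have u: "u \<in> I" "u \<noteq> v" "(u, v) \<in> E" using e Suc.prems by (auto simp: irrefl_def sym_def)
      have sym: "(j, i) \<in> E" using ij Suc.prems by (auto simp: sym_def)
      have "\<not> u < i" using Suc.prems(5)[of u i v j] u ij v by auto
      moreover have "\<not> u > j" using Suc.prems(5)[of i v j u] e ij v by auto
      ultimately have "y < u" using n v(4)[of u] y(3)[of u] u by force
      then show False using min[OF e, of y] y v \<open>\<not> u > j\<close> by auto
    qed
    then show ?thesis using v by blast
  qed
  then obtain v x y where v: "v \<in> I" "\<And>u. (v, u) \<in> E \<Longrightarrow> u = x \<or> u = y" by blast
  have "\<exists>c. colouring 3 (I - {v}) (E \<inter> (I - {v}) \<times> (I - {v})) c"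
    using Suc.prems v(1) Suc.hyps(2) by (intro Suc.hyps(1)) (auto simp: sym_def irrefl_def)
  then obtain c where c: "colouring 3 (I - {v}) (E \<inter> (I - {v}) \<times> (I - {v})) c" by blast
  have "\<exists>t<3. t \<noteq> c x \<and> t \<noteq> (c y :: nat)" by presburger
  then obtain t where t: "t < 3" "t \<noteq> c x" "t \<noteq> c y" by blast
  have "colouring 3 I E (c(v := t))"
  proof -
    have "(c(v := t)) p \<noteq> (c(v := t)) q" if e: "(p, q) \<in> E" for p q
    proof
      assume eq: "(c(v := t)) p = (c(v := t)) q"
      have "(q, p) \<in> E" "p \<noteq> q" "p \<in> I" "q \<in> I"
        using e Suc.prems by (auto simp: sym_def irrefl_def)
      then show False using e eq c t v(2)[of p] v(2)[of q]
        by (auto simp: colouring_def split: if_splits)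
    qed
    moreover have "(c(v := t)) u < 3" if "u \<in> I" for u using c t that by (auto simp: colouring_def)
    ultimately show ?thesis by (rule colouringI[rotated])
  qed
  then show ?case by blast
qed

context dicycle
begin

text \<open>
A theta on the cycle, given by positions: within a window of length \<open>n\<close> distinct positions are distinct
vertices, so all conditions turn into arithmetic.
\<close>

lemma window_theta:
  assumes w: "{u, v} \<union> set ps \<union> set qs \<subseteq> {a..<a + n}"
    and "distinct (u # ps @ [v])" "successively jump (u # ps @ [v])"
    and "distinct (u # qs @ [v])" "successively jump (u # qs @ [v])"
    and disj: "set ps \<inter> set qs = {}" and len: "1 \<le> length ps" "2 \<le> length qs"
  shows False
proof -
  have "dipath A (g u # map g ps @ [g v])" "dipath A (g u # map g qs @ [g v])"
    using dipath_map[of "u # ps @ [v]" a] dipath_map[of "u # qs @ [v]" a] assms by auto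
  moreover have "g ` set ps \<inter> g ` set qs = {}"
    using inj_on_image_Int[OF g_inj[of a], of "set ps" "set qs"] w disj by simp
  ultimately show False
    using theta_freeD[OF theta_free, of "g u" "map g ps" "g v" "map g qs"] len by auto
qed

lemmas upto_simps = successively_Cons successively_append_iff hd_append hd_upto last_upto

text \<open>
Let the chords be \<open>a \<rightarrow> b\<close> and \<open>c \<rightarrow> d\<close>, with their ends in the cyclic order \<open>a, c, b, d\<close>. There are two paths
from \<open>a\<close> to \<open>d\<close>, through \<open>b\<close> and through \<open>c\<close>, which form a theta unless \<open>c\<close> follows \<open>a\<close> and \<open>d\<close>
follows \<open>b\<close> directly. There are two paths from \<open>c\<close> to \<open>b\<close>, one on the cycle and one through \<open>d\<close> and \<open>a\<close>; the
latter has at least two inner vertices, so they form a theta unless \<open>b\<close> follows \<open>c\<close> directly.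
\<close>

lemma crossing:
  assumes "i < k" "k < j" "j < l" "l < i + n" and ch: "jump i j" "jump k l"
  shows "k = i + 1 \<and> j = i + 2 \<and> l = i + 3"
proof -
  have l: "jump (l - 1) l" "jump i (i + 1)" "jump k (k + 1)" "jump (j - 1) j" by simp_all
  have "\<not> 2 \<le> k - i"
  proof
    assume "2 \<le> k - i"
    then show False
      by (intro window_theta[of i l "[j..l - 1]" "[i + 1..k]" i]) (use assms l in \<open>auto simp: upto_simps\<close>)
  qed
  moreover have "\<not> 2 \<le> l - j"
  proof
    assume "2 \<le> l - j"
    then show False
      by (intro window_theta[of i l "[i + 1..k]" "[j..l - 1]" i]) (use assms l in \<open>auto simp: upto_simps\<close>)
  qed
  moreover have "\<not> 2 \<le> j - k"
  proof
    assume "2 \<le> j - k"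
    then show False
      by (intro window_theta[of k j "[k + 1..j - 1]" "[l..i + n]" k]) (use assms l in \<open>auto simp: upto_simps\<close>)
  qed
  ultimately show ?thesis using assms by auto
qed

text \<open>
The positions \<open>i - 1, \<dots>, i + 2\<close> are those of two crossing chords. By \<open>crossing\<close> there are no
other crossings, and it is the second of the four positions that will get the fourth colour.
\<close>

definition skip :: "int \<Rightarrow> bool" where "skip i \<longleftrightarrow> jump (i - 1) (i + 1) \<and> jump i (i + 2)"

lemma skip_period: "skip (i + n) = skip i"
proof -
  have "i + n - 1 = (i - 1) + n" "i + n + 1 = (i + 1) + n" "i + n + 2 = (i + 2) + n" by simp_all
  then show ?thesis unfolding skip_def by (simp only: jump_period)
qed

text \<open>
The paths through the positions \<open>i - 1, i + 1, i + 3\<close> and \<open>i - 1, i, i + 2, i + 3\<close> form a theta; they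
have distinct ends because the cycle has more than four vertices.
\<close>

lemma three_skips:
  assumes "jump (i - 1) (i + 1)" "jump i (i + 2)" "jump (i + 1) (i + 3)"
  shows False
proof -
  have "i + 2 + 1 = i + 3" by simp
  then have "jump (i + 2) (i + 3)" using jump_step(1)[of "i + 2"] by metis
  then show False
    by (intro window_theta[of "i - 1" "i + 3" "[i + 1]" "[i, i + 2]" "i - 1"]) (use n assms in auto)
qed

text \<open>
An arc from position \<open>i\<close> other than those to \<open>i + 1\<close>, \<open>i + 2\<close> and \<open>i - 1\<close> would cross the chord from
\<open>i - 1\<close> to \<open>i + 1\<close>, contrary to \<open>crossing\<close>. If \<open>m\<close> is one of these three positions, then the chords at
\<open>i\<close> and at \<open>m\<close> include three consecutive ones.
\<close>

lemma skip_independent: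
  assumes "skip i" "skip m" "i < m" "m < i + n"
  shows "\<not> jump i m"
proof
  assume im: "jump i m"
  have jump: "jump (i - 1) (i + 1)" "jump i (i + 2)" "jump (m - 1) (m + 1)" "jump m (m + 2)"
    using assms by (auto simp: skip_def)
  consider "m = i + 1" | "m = i + 2" | "m = i - 1 + n" | "i + 2 < m" "m < i - 1 + n"
    using assms by linarith
  then show False
  proof cases
    case 1
    then show False using jump three_skips[of i] by (simp add: add.commute)
  next
    case 2
    then show False using jump three_skips[of i] by (simp add: add.commute)
  next
    case 3
    have "skip (i - 1)" using assms(2) skip_period[of "i - 1"] 3 by (simp add: add.commute)
    then show False using jump three_skips[of "i - 1"] by (auto simp add: skip_def add.commute)
  next
    case 4
    then show False using crossing[of "i - 1" i "i + 1" m] jump im by auto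
  qed
qed

text \<open>
Cut open the cycle at 0. According to the directions of the two edges, \<open>crossing\<close> applies to the order
\<open>i, k, j, l\<close> or to one of its rotations, and each of them puts a different one of the four into second place.
\<close>

lemma crossing_skip:
  assumes "0 \<le> i" "i < k" "k < j" "j < l" "l < n" and "jump i j \<or> jump j i" "jump k l \<or> jump l k"
  shows "skip i \<or> skip k \<or> skip j \<or> skip l"
proof -
  consider "jump i j" "jump k l" | "jump i j" "jump (l - n) k"
    | "jump j (i + n)" "jump k l" | "jump j (i + n)" "jump l (k + n)"
    using assms by auto
  then show ?thesis
  proof cases
    case 1
    have "k = i + 1 \<and> j = i + 2 \<and> l = i + 3" using 1 assms by (intro crossing) auto
    then have "i = k - 1" "j = k + 1" "l = k + 2" by auto
    then have "skip k" using 1 unfolding skip_def by metis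
    then show ?thesis by simp
  next
    case 2
    have "i = l - n + 1 \<and> k = l - n + 2 \<and> j = l - n + 3" using 2 assms by (intro crossing) auto
    then have "l - n = i - 1" "k = i + 1" "j = i + 2" by auto
    then have "skip i" using 2 unfolding skip_def by metis
    then show ?thesis by simp
  next
    case 3
    have "j = k + 1 \<and> l = k + 2 \<and> i + n = k + 3" using 3 assms by (intro crossing) auto
    then have "i + n = j + 2" "k = j - 1" "l = j + 1" by auto
    then have "skip j" using 3 unfolding skip_def by metis
    then show ?thesis by simp
  next
    case 4
    have "l = j + 1 \<and> i + n = j + 2 \<and> k + n = j + 3" using 4 assms by (intro crossing) auto
    then have "i + n = l + 1" "j = l - 1" "k + n = l + 2" by auto
    then have "skip l" using 4 unfolding skip_def by metis
    then show ?thesis by simp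
  qed
qed

lemma hamiltonian_4_colourable:
  assumes "V = C"
  shows "\<exists>c. colouring 4 V A c"
proof -
  define I where "I = {i. 0 \<le> i \<and> i < n \<and> \<not> skip i}"
  define E where "E = {(i, j). i \<in> I \<and> j \<in> I \<and> (jump i j \<or> jump j i)}"
  have fin: "finite I" by (rule finite_subset[of _ "{0..n}"]) (auto simp: I_def)
  have "\<exists>c. colouring 3 I E c"
  proof (rule noncrossing_3_colourable[OF fin])
    fix i k j l assume "i < k" "k < j" "j < l" "(i, j) \<in> E" "(k, l) \<in> E"
    then show False using crossing_skip[of i k j l] by (auto simp: E_def I_def)
  qed (use loopless in \<open>auto simp: E_def sym_def irrefl_def jump_def\<close>)
  then obtain c where c: "colouring 3 I E c" by blast
  define ix where "ix v = (SOME i. 0 \<le> i \<and> i < n \<and> g i = v)" for v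
  have ix: "0 \<le> ix v \<and> ix v < n \<and> g (ix v) = v" if "v \<in> V" for v
  proof -
    have "\<exists>i. 0 \<le> i \<and> i < n \<and> g i = v" using C_window[of v 0] that assms by fastforce
    then show ?thesis unfolding ix_def by (rule someI_ex)
  qed
  define d where "d v = (if skip (ix v) then 3 else c (ix v))" for v
  have c3: "c i < 3" if "i \<in> I" for i using c that by (auto simp: colouring_def)
  have "d u \<noteq> d v" if uv: "(u, v) \<in> A" for u v
  proof -
    have V: "u \<in> V" "v \<in> V" using uv arcs by auto
    have j: "jump (ix u) (ix v)" using uv ix V by (auto simp: jump_def)
    have ne: "ix u \<noteq> ix v" using uv ix V loopless by metis
    show ?thesis
    proof (cases "skip (ix u) \<and> skip (ix v)")
      case True
      have b: "0 \<le> ix u" "ix u < n" "0 \<le> ix v" "ix v < n" using ix V by auto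
      have False
      proof (cases "ix u < ix v")
        case True
        then show False using skip_independent[of "ix u" "ix v"] \<open>skip _ \<and> skip _\<close> b j by simp
      next
        case False
        then show False using skip_independent[of "ix u" "ix v + n"] \<open>skip _ \<and> skip _\<close> b j ne
          by (simp add: skip_period)
      qed
      then show ?thesis ..
    next
      case False
      consider "skip (ix u)" "\<not> skip (ix v)" "ix v \<in> I" | "\<not> skip (ix u)" "ix u \<in> I" "skip (ix v)"
        | "\<not> skip (ix u)" "\<not> skip (ix v)" "(ix u, ix v) \<in> E"
        using ix[OF V(1)] ix[OF V(2)] j False by (auto simp: I_def E_def)
      then show ?thesis
        using c3[of "ix v"] c3[of "ix u"] c by cases (auto simp: d_def colouring_def)
    qed
  qed
  moreover have "d v < 4" if "v \<in> V" for v
    using c3[of "ix v"] ix[OF that] by (auto simp: d_def I_def)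
  ultimately show ?thesis by (intro exI[of _ d] colouringI)
qed

end

section \<open>Vertices off a longest cycle\<close>

lemma enter_set:
  assumes "(u, v) \<in> A\<^sup>*" "u \<notin> W" "v \<in> W"
  shows "\<exists>a j. a \<notin> W \<and> j \<in> W \<and> (a, j) \<in> A \<and> (j, v) \<in> (A \<inter> W \<times> W)\<^sup>*"
  using assms
proof induction
  case (step v w)
  then show ?case by (cases "v \<in> W") (auto intro: rtrancl.rtrancl_into_rtrancl)
qed auto

lemma leave_set:
  assumes "(u, v) \<in> A\<^sup>*" "u \<in> W" "v \<notin> W"
  shows "\<exists>l b. l \<in> W \<and> b \<notin> W \<and> (u, l) \<in> (A \<inter> W \<times> W)\<^sup>* \<and> (l, b) \<in> A"
  using assms
proof (induction rule: converse_rtrancl_induct)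
  case (step u w)
  then show ?case by (cases "w \<in> W") (auto intro: converse_rtrancl_into_rtrancl)
qed auto

text \<open>
Separation is expressed by two sides that overlap in \<open>x\<close>, because these are the digraphs to which the
induction passes.
\<close>

definition cut_vertex :: "'a set \<Rightarrow> ('a \<times> 'a) set \<Rightarrow> 'a \<Rightarrow> bool" where
  "cut_vertex V A x \<longleftrightarrow>
     (\<exists>P Q. V = P \<union> Q \<and> P \<inter> Q = {x} \<and> P \<noteq> {x} \<and> Q \<noteq> {x} \<and> A \<subseteq> P \<times> P \<union> Q \<times> Q)"

lemma cut_vertexI:
  assumes "A \<subseteq> V \<times> V" "x \<in> V" "U \<subseteq> V" "k \<in> U" "x \<notin> U" "y \<in> V" "y \<notin> U" "y \<noteq> x"
    and "\<And>u v. (u, v) \<in> A \<Longrightarrow> u \<in> U \<Longrightarrow> v = x \<or> v \<in> U"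
    and "\<And>u v. (u, v) \<in> A \<Longrightarrow> v \<in> U \<Longrightarrow> u = x \<or> u \<in> U"
  shows "cut_vertex V A x"
  unfolding cut_vertex_def
proof (intro exI conjI)
  show "V = (U \<union> {x}) \<union> (V - U)" "(U \<union> {x}) \<inter> (V - U) = {x}" using assms by auto
  show "U \<union> {x} \<noteq> {x}" "V - U \<noteq> {x}" using assms by auto
  show "A \<subseteq> (U \<union> {x}) \<times> (U \<union> {x}) \<union> (V - U) \<times> (V - U)"
  proof
    fix e assume "e \<in> A"
    moreover obtain u v where "e = (u, v)" by (cases e)
    ultimately show "e \<in> (U \<union> {x}) \<times> (U \<union> {x}) \<union> (V - U) \<times> (V - U)"
      using assms(1) assms(9,10)[of u v] by blast
  qed
qed

text \<open>
The situation that remains once short cycles and cut vertices have been dealt with.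
\<close>

locale longest_dicycle = dicycle +
  assumes strong: "u \<in> V \<Longrightarrow> v \<in> V \<Longrightarrow> (u, v) \<in> A\<^sup>*"
    and longest: "cycle_through A e xs \<Longrightarrow> int (length xs) \<le> n"
    and no_cut: "\<not> cut_vertex V A x"
begin

lemma C_memI [simp]: "g i \<in> C" by (simp add: C_def)

lemma g_in_V [simp]: "g i \<in> V" using C_subset by (auto simp: C_def)

lemma short_ear:
  assumes "b \<in> C" "g i \<noteq> b" and ps: "dipath A ps" "ps \<noteq> []" "set ps \<inter> C = {}"
    and ends: "(g i, hd ps) \<in> A" "(last ps, b) \<in> A"
  shows "length ps = 1 \<and> b = g (i + 2)"
proof -
  obtain j where "i \<le> j" "j < i + n" "b = g j" using C_window assms(1) by blast
  moreover have "i \<noteq> j" using assms(2) \<open>b = g j\<close> by auto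
  ultimately have "length ps = 1 \<and> j = i + 2" using ps ends by (intro ear longest) auto
  then show ?thesis using \<open>b = g j\<close> by simp
qed

text \<open>
If every walk that leaves the cycle came back to the vertex where it had left, then each vertex off the
cycle could be reached from only one vertex of the cycle, and could reach only this one.
Neighbours off the cycle would have the same vertex assigned to them, so the set \<open>K\<close> of the vertices that
are assigned \<open>g i\<close> would be separated from the rest by \<open>g i\<close>.
\<close>

lemma exists_short_ear:
  assumes "V \<noteq> C"
  shows "\<exists>x\<in>V - C. \<exists>i. (g i, x) \<in> A \<and> (x, g (i + 2)) \<in> A"
proof (rule ccontr)
  assume none: "\<not> ?thesis"
  define W where "W = V - C"
  define R where "R = A \<inter> W \<times> W"
  \<comment> \<open>Such a walk with distinct ends contains an ear, and by \<open>short_ear\<close> this is the required one.\<close>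
  have closed: "a = b"
    if "a \<in> C" "(a, j) \<in> A" "j \<in> W" "(j, k) \<in> R\<^sup>*" "(k, l) \<in> R\<^sup>*" "(l, b) \<in> A" "b \<in> C" for a b j k l
  proof (rule ccontr)
    assume "a \<noteq> b"
    have "(j, l) \<in> R\<^sup>*" "j \<in> W" using that by simp_all
    then obtain ps where ps: "ps \<noteq> []" "dipath A ps" "hd ps = j" "last ps = l" "set ps \<subseteq> W"
      using rtrancl_imp_dipath[of j l A W] by (auto simp: R_def)
    obtain i where a: "a = g i" using \<open>a \<in> C\<close> by (auto simp: C_def)
    have "length ps = 1 \<and> b = g (i + 2)"
      using \<open>a \<noteq> b\<close> that ps by (intro short_ear) (auto simp: a W_def)
    then show False using none ps that a
      by (cases ps) (auto simp: W_def)
  qed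
  have enter: "\<exists>a j. a \<in> C \<and> j \<in> W \<and> (a, j) \<in> A \<and> (j, k) \<in> R\<^sup>*" if "k \<in> W" for k
    using enter_set[of "g 0" k A W] strong[of "g 0" k] that arcs by (auto simp: W_def R_def)
  have leave: "\<exists>l b. b \<in> C \<and> l \<in> W \<and> (l, b) \<in> A \<and> (k, l) \<in> R\<^sup>*" if "k \<in> W" for k
    using leave_set[of k "g 0" A W] strong[of k "g 0"] that arcs by (auto simp: W_def R_def)
  obtain k0 where "k0 \<in> W" using assms C_subset by (auto simp: W_def)
  then obtain i j0 where a: "j0 \<in> W" "(g i, j0) \<in> A" "(j0, k0) \<in> R\<^sup>*"
    using enter by (metis C_def imageE)
  define K where "K = {k \<in> W. \<exists>j\<in>W. (g i, j) \<in> A \<and> (j, k) \<in> R\<^sup>*}"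
  have "cut_vertex V A (g i)"
  proof (rule cut_vertexI[OF arcs])
    show "k0 \<in> K" using a \<open>k0 \<in> W\<close> by (auto simp: K_def)
    show "g (i + 1) \<noteq> g i" using g_neq[of i "i + 1"] n by auto
    show "K \<subseteq> V" "g i \<notin> K" "g (i + 1) \<notin> K" by (auto simp: K_def W_def)
    fix u v assume uv: "(u, v) \<in> A"
    then have V: "u \<in> V" "v \<in> V" using arcs by auto
    show "v = g i \<or> v \<in> K" if "u \<in> K"
    proof (cases "v \<in> C")
      case True
      then show ?thesis using that closed[of "g i" _ u u v] uv by (auto simp: K_def)
    next
      case False
      then have "(u, v) \<in> R" "v \<in> W" using uv V that by (auto simp: R_def K_def W_def)
      then show ?thesis using that by (auto simp: K_def intro: rtrancl.rtrancl_into_rtrancl)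
    qed
    show "u = g i \<or> u \<in> K" if v: "v \<in> K"
    proof -
      obtain l b where b: "b \<in> C" "l \<in> W" "(l, b) \<in> A" "(v, l) \<in> R\<^sup>*" using leave[of v] v unfolding K_def by blast
      then have "g i = b" using closed[of "g i" _ v l b] v by (auto simp: K_def)
      show ?thesis
      proof (cases "u \<in> C")
        case True
        then show ?thesis using closed[of u v v l b] uv v b \<open>g i = b\<close> by (auto simp: K_def)
      next
        case False
        then have R: "(u, v) \<in> R" and u: "u \<in> W" using uv V v by (auto simp: R_def K_def W_def)
        obtain a' j where a': "a' \<in> C" "j \<in> W" "(a', j) \<in> A" "(j, u) \<in> R\<^sup>*" using enter u by blast
        then have "a' = b" using closed[of a' j v l b] R b by (auto intro: rtrancl.rtrancl_into_rtrancl)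
        then show ?thesis using a' u \<open>g i = b\<close> by (auto simp: K_def)
      qed
    qed
  qed simp_all
  then show False using no_cut by blast
qed

text \<open>
Let \<open>W\<close> be the set of the other vertices off the cycle, \<open>T\<close> the set of those that can be reached from the
cycle within \<open>W\<close>, and \<open>E\<close> the set of those that can reach the cycle within \<open>W\<close>. No arc goes from \<open>x\<close> to \<open>E\<close>:
continued to the cycle it would be part of an ear from \<open>g i\<close> with more than one inner vertex, or, if it
comes back to \<open>g i\<close>, it would form a theta with the path from \<open>x\<close> to \<open>g i\<close> through \<open>g (i + 2)\<close> along the
cycle. Dually no arc goes from \<open>T\<close> to \<open>x\<close>. Strong connectivity now yields \<open>T = E\<close>: a walk from \<open>T\<close> to the
cycle cannot pass through \<open>x\<close>. So \<open>x\<close> has no neighbour in \<open>T\<close>, and if it had one in \<open>W - T\<close>, then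
it would separate \<open>W - T\<close> from the rest.
\<close>

lemma short_ear_isolated:
  assumes x: "x \<in> V - C" and ix: "(g i, x) \<in> A" "(x, g (i + 2)) \<in> A"
    and k: "k \<in> V - C" and adj: "(x, k) \<in> A \<or> (k, x) \<in> A"
  shows False
proof -
  define W where "W = V - C - {x}"
  define R where "R = A \<inter> W \<times> W"
  define T where "T = {w\<in>W. \<exists>a\<in>C. \<exists>j\<in>W. (a, j) \<in> A \<and> (j, w) \<in> R\<^sup>*}"
  define E where "E = {w\<in>W. \<exists>b\<in>C. \<exists>l\<in>W. (l, b) \<in> A \<and> (w, l) \<in> R\<^sup>*}"
  have path: "\<exists>ps. ps \<noteq> [] \<and> dipath A ps \<and> hd ps = u \<and> last ps = v \<and> set ps \<subseteq> W"
    if "(u, v) \<in> R\<^sup>*" "u \<in> W" for u v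
    using rtrancl_imp_dipath[of u v A W] that by (simp add: R_def)
  have gnx: "x \<noteq> g m" for m using x by auto
  have xE: "(x, w) \<notin> A" if "w \<in> E" for w
  proof
    assume xw: "(x, w) \<in> A"
    obtain b l where b: "w \<in> W" "b \<in> C" "l \<in> W" "(l, b) \<in> A" "(w, l) \<in> R\<^sup>*" using \<open>w \<in> E\<close> by (auto simp: E_def)
    obtain ps where ps: "ps \<noteq> []" "dipath A ps" "hd ps = w" "last ps = l" "set ps \<subseteq> W"
      using path b by blast
    show False
    proof (cases "b = g i")
      case False
      have "length (x # ps) = 1 \<and> b = g (i + 2)"
        by (rule short_ear) (use False ix x b xw ps in \<open>auto simp: dipath_Cons W_def\<close>)
      then show False using ps by simp
    next
      case True
      have eq: "seg (i + 2) (i + n) = seg (i + 2) (i + n - 1) @ [g i]"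
        using n by (simp add: seg_def upto_rec2[of "i + 2" "i + n"])
      have d: "dipath A (seg (i + 2) (i + n))" by (rule dipath_seg) simp
      show False
      proof (rule theta_freeD[OF theta_free])
        show "dipath A (x # ps @ [g i])" using ps b True x xw
          by (auto simp: dipath_Cons dipath_append W_def hd_append)
        show "dipath A (x # seg (i + 2) (i + n - 1) @ [g i])"
          using d x ix n unfolding eq[symmetric] by (auto simp: dipath_Cons)
        show "set ps \<inter> set (seg (i + 2) (i + n - 1)) = {}" using ps by (auto simp: W_def)
        show "1 \<le> length ps" using ps by (cases ps) auto
      qed (use n in simp)
    qed
  qed
  have Tx: "(w, x) \<notin> A" if "w \<in> T" for w
  proof
    assume wx: "(w, x) \<in> A"
    obtain m j where b: "w \<in> W" "j \<in> W" "(g m, j) \<in> A" "(j, w) \<in> R\<^sup>*" using \<open>w \<in> T\<close> by (auto simp: T_def C_def)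
    obtain ps where ps: "ps \<noteq> []" "dipath A ps" "hd ps = j" "last ps = w" "set ps \<subseteq> W"
      using path b by blast
    show False
    proof (cases "g m = g (i + 2)")
      case False
      have "length (ps @ [x]) = 1 \<and> g (i + 2) = g (m + 2)"
        by (rule short_ear) (use False ix x b wx ps in \<open>auto simp: dipath_append W_def\<close>)
      then show False using ps by simp
    next
      case True
      have eq: "seg (i + 2) (i + n) = g (i + 2) # seg (i + 3) (i + n)"
      proof -
        have "i + 2 + 1 = i + 3" and le: "i + 2 \<le> i + n" using n by simp_all
        then have "[i + 2..i + n] = (i + 2) # [i + 3..i + n]"
          using upto_rec1[of "i + 2" "i + n"] le by metis
        then show ?thesis by (simp add: seg_def)
      qed
      have d: "dipath A (seg (i + 2) (i + n))" by (rule dipath_seg) simp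
      have l: "last (seg (i + 2) (i + n)) = g i" using n by (subst last_seg) auto
      show False
      proof (rule theta_freeD[OF theta_free])
        show "dipath A (g (i + 2) # ps @ [x])" using ps b True x wx
          by (auto simp: dipath_Cons dipath_append W_def hd_append)
        have "dipath A (seg (i + 2) (i + n) @ [x])"
          using d x ix n l by (auto simp: dipath_append)
        then show "dipath A (g (i + 2) # seg (i + 3) (i + n) @ [x])" by (simp add: eq)
        show "set ps \<inter> set (seg (i + 3) (i + n)) = {}" using ps by (auto simp: W_def)
        show "1 \<le> length ps" using ps by (cases ps) auto
      qed (use n in simp)
    qed
  qed
  have "T \<subseteq> E"
  proof
    fix w assume w: "w \<in> T"
    then have "w \<in> W" by (simp add: T_def)
    then obtain l b where lb: "l \<in> W" "b \<notin> W" "(w, l) \<in> R\<^sup>*" "(l, b) \<in> A"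
      using leave_set[of w "g i" A W] strong[of w "g i"] by (auto simp: W_def R_def)
    have "l \<in> T" using w lb unfolding T_def by (blast intro: rtrancl_trans)
    then have "b \<in> C" using Tx lb arcs by (auto simp: W_def)
    then show "w \<in> E" using lb \<open>w \<in> W\<close> by (auto simp: E_def)
  qed
  moreover have "E \<subseteq> T"
  proof
    fix w assume w: "w \<in> E"
    then have "w \<in> W" by (simp add: E_def)
    then obtain a j where aj: "j \<in> W" "a \<notin> W" "(j, w) \<in> R\<^sup>*" "(a, j) \<in> A"
      using enter_set[of "g i" w A W] strong[of "g i" w] by (auto simp: W_def R_def)
    have "j \<in> E" using w aj unfolding E_def by (blast intro: rtrancl_trans)
    then have "a \<in> C" using xE aj arcs by (auto simp: W_def)
    then show "w \<in> T" using aj \<open>w \<in> W\<close> by (auto simp: T_def)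
  qed
  ultimately have TE: "T = E" by blast
  have "cut_vertex V A x"
  proof (rule cut_vertexI[OF arcs])
    show "k \<in> W - T" using adj Tx xE TE k loopless by (auto simp: W_def)
    show "g i \<noteq> x" using gnx by metis
    show "W - T \<subseteq> V" "x \<notin> W - T" "g i \<notin> W - T" "x \<in> V" using x by (auto simp: W_def)
    fix u v assume uv: "(u, v) \<in> A"
    then have V: "u \<in> V" "v \<in> V" using arcs by auto
    show "v = x \<or> v \<in> W - T" if u: "u \<in> W - T"
    proof (rule ccontr)
      assume v: "\<not> ?thesis"
      then consider "v \<in> C" | "v \<in> T" using V by (auto simp: W_def)
      then have "u \<in> E"
      proof cases
        case 1
        then show ?thesis using u uv by (auto simp: E_def)
      next
        case 2
        then have "v \<in> E" "(u, v) \<in> R" using TE u uv by (auto simp: R_def T_def)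
        then show ?thesis using u by (auto simp: E_def intro: converse_rtrancl_into_rtrancl)
      qed
      then show False using u TE by auto
    qed
    show "u = x \<or> u \<in> W - T" if v: "v \<in> W - T"
    proof (rule ccontr)
      assume u: "\<not> ?thesis"
      then consider "u \<in> C" | "u \<in> T" using V by (auto simp: W_def)
      then have "v \<in> T"
      proof cases
        case 1
        then show ?thesis using v uv by (auto simp: T_def)
      next
        case 2
        then have "(u, v) \<in> R" using v uv by (auto simp: R_def T_def)
        then show ?thesis using 2 v by (auto simp: T_def intro: rtrancl.rtrancl_into_rtrancl)
      qed
      then show False using v by auto
    qed
  qed simp
  then show False using no_cut by blast
qed

text \<open>
A neighbour \<open>k\<close> of \<open>x\<close> lies on the cycle by \<open>short_ear_isolated\<close>. Suppose that it is neither end. If the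
arc is \<open>x \<rightarrow> k\<close>, then \<open>g i, x, k\<close> is an ear; if it is \<open>k \<rightarrow> x\<close>, then \<open>k, x, g (i + 2)\<close> is
one. By \<open>short_ear\<close> an ear advances by exactly two positions, so \<open>k\<close> is the other end of the given ear after all.
\<close>

lemma short_ear_neighbours:
  assumes x: "x \<in> V - C" and ix: "(g i, x) \<in> A" "(x, g (i + 2)) \<in> A"
    and adj: "(x, k) \<in> A \<or> (k, x) \<in> A"
  shows "k = g i \<or> k = g (i + 2)"
proof (rule ccontr)
  assume nk: "\<not> ?thesis"
  have "k \<in> V" using adj arcs by auto
  then have "k \<in> C" using short_ear_isolated[OF x ix, of k] adj by blast
  from adj show False
  proof
    assume "(x, k) \<in> A"
    then have "k = g (i + 2)" using short_ear[of k i "[x]"] nk x ix \<open>k \<in> C\<close> by auto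
    then show False using nk by blast
  next
    assume kx: "(k, x) \<in> A"
    obtain m where m: "k = g m" using \<open>k \<in> C\<close> by (auto simp: C_def)
    have "g (i + 2) = g (m + 2)" using short_ear[of "g (i + 2)" m "[x]"] nk x ix kx m by auto
    then have "(i + 2) mod n = (m + 2) mod n" by (simp add: g_eq)
    then have "i mod n = m mod n" by (simp add: mod_eq_dvd_iff)
    then show False using nk m by (simp add: g_eq)
  qed
qed

end

section \<open>Four colours suffice\<close>

text \<open>
For showing that deleting vertices preserves strong connectivity: project each walk to the
vertices that are kept.
\<close>

lemma rtrancl_retract:
  assumes "(u, v) \<in> A\<^sup>*" and "\<And>p q. (p, q) \<in> A \<Longrightarrow> (\<pi> p, \<pi> q) \<in> B\<^sup>*"
  shows "(\<pi> u, \<pi> v) \<in> B\<^sup>*"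
  using assms(1) by induction (auto intro: rtrancl_trans dest: assms(2))

lemma dipath_subset:
  "dipath A xs \<Longrightarrow> A \<subseteq> V \<times> V \<Longrightarrow> xs \<noteq> [] \<Longrightarrow> hd xs \<in> V \<Longrightarrow> set xs \<subseteq> V"
  by (induction xs rule: induct_list012) auto

lemma cycle_length_le_card:
  assumes "finite V" "A \<subseteq> V \<times> V" "cycle_through A e xs"
  shows "length xs \<le> card V"
proof -
  have "snd e \<in> V" using assms by (cases e) (auto simp: cycle_through_def)
  then have "set xs \<subseteq> V" using assms by (intro dipath_subset) (auto simp: cycle_through_def)
  moreover have "distinct xs" using assms by (auto simp: cycle_through_def dipath_def)
  ultimately show ?thesis using card_mono[OF assms(1)] distinct_card by metis
qed

lemma dicycleI:
  assumes "A \<subseteq> V \<times> V" "\<And>v. (v, v) \<notin> A" "theta_free A"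
    and cyc: "cycle_through A e zs" and len: "5 \<le> length zs"
  shows "dicycle V A (int (length zs)) (\<lambda>i. zs ! nat (i mod int (length zs)))"
proof
  let ?n = "int (length zs)"
  have zs: "dipath A zs" "zs \<noteq> []" "(last zs, hd zs) \<in> A" using cyc by (auto simp: cycle_through_def)
  have b: "nat (i mod ?n) < length zs" "0 \<le> i mod ?n" "i mod ?n < ?n" for i
  proof -
    have "0 < ?n" using len by linarith
    then show "0 \<le> i mod ?n" "i mod ?n < ?n" by simp_all
    then show "nat (i mod ?n) < length zs" by linarith
  qed
  show "(zs ! nat (i mod ?n), zs ! nat ((i + 1) mod ?n)) \<in> A" for i
  proof (cases "i mod ?n + 1 < ?n")
    case True
    then have "(i + 1) mod ?n = i mod ?n + 1" using b[of i]
      by (metis mod_add_left_eq mod_pos_pos_trivial add_increasing2 zero_le_one)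
    then have e: "nat ((i + 1) mod ?n) = Suc (nat (i mod ?n))" using b[of i] by (simp add: nat_add_distrib)
    then have "Suc (nat (i mod ?n)) < length zs" using b[of "i + 1"] by simp
    then show ?thesis using zs(1) unfolding e dipath_def by (auto dest: successively_conv_nth[THEN iffD1])
  next
    case False
    then have l: "i mod ?n = ?n - 1" using b[of i] by linarith
    then have "(i + 1) mod ?n = 0" by (metis diff_add_cancel mod_add_left_eq mod_self)
    moreover have "nat (?n - 1) = length zs - 1" by linarith
    then have "zs ! nat (i mod ?n) = last zs" using l zs(2) by (simp add: last_conv_nth)
    ultimately show ?thesis using zs by (simp add: hd_conv_nth)
  qed
  show "zs ! nat (i mod ?n) = zs ! nat (j mod ?n) \<longleftrightarrow> i mod ?n = j mod ?n" for i j
    using zs(1) b[of i] b[of j] by (auto simp: dipath_def nth_eq_iff_index_eq)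
qed (use assms in auto)

text \<open>
Exchanging two colours on \<open>Q\<close> makes the colourings agree at \<open>x\<close>.
\<close>

lemma cut_vertex_colouring:
  assumes V: "V = P \<union> Q" "P \<inter> Q = {x}" "A \<subseteq> P \<times> P \<union> Q \<times> Q"
    and c: "colouring k P (A \<inter> P \<times> P) c" and d: "colouring k Q (A \<inter> Q \<times> Q) d"
  shows "\<exists>c. colouring k V A c"
proof -
  define \<sigma> where "\<sigma> t = (if t = d x then c x else if t = c x then d x else t)" for t
  have inj: "\<sigma> s = \<sigma> t \<longleftrightarrow> s = t" for s t by (auto simp: \<sigma>_def)
  have x: "x \<in> P" "x \<in> Q" using V by auto
  define f where "f v = (if v \<in> P then c v else \<sigma> (d v))" for v
  have P: "f v = c v" if "v \<in> P" for v using that by (simp add: f_def)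
  have Q: "f v = \<sigma> (d v)" if "v \<in> Q" for v
    using that V(2) by (cases "v = x") (auto simp: f_def \<sigma>_def)
  have ck: "c v < k" if "v \<in> P" for v using c that by (auto simp: colouring_def)
  have dk: "d v < k" if "v \<in> Q" for v using d that by (auto simp: colouring_def)
  have "\<sigma> (d v) < k" if "v \<in> Q" for v using dk[OF that] ck[OF x(1)] dk[OF x(2)] by (auto simp: \<sigma>_def)
  then have "f v < k" if "v \<in> V" for v using that V(1) ck P Q by force
  moreover have "f u \<noteq> f v" if uv: "(u, v) \<in> A" for u v
  proof (cases "u \<in> P \<and> v \<in> P")
    case True
    then show ?thesis using P colouring_neq[OF c, of u v] uv by simp
  next
    case False
    then have "u \<in> Q" "v \<in> Q" using uv V(3) by auto
    then show ?thesis using Q inj colouring_neq[OF d, of u v] uv by simp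
  qed
  ultimately show ?thesis by (intro exI[of _ f] colouringI)
qed

text \<open>
An excursion to \<open>Q\<close> starts and ends at \<open>x\<close>, so projecting \<open>Q\<close> to \<open>x\<close> turns walks into walks in \<open>P\<close>.
\<close>

lemma cut_vertex_strong:
  assumes "P \<inter> Q = {x}" "A \<subseteq> P \<times> P \<union> Q \<times> Q" "u \<in> P" "v \<in> P" "(u, v) \<in> A\<^sup>*"
  shows "(u, v) \<in> (A \<inter> P \<times> P)\<^sup>*"
proof -
  define \<pi> where "\<pi> w = (if w \<in> P then w else x)" for w
  have "(\<pi> p, \<pi> q) \<in> (A \<inter> P \<times> P)\<^sup>*" if "(p, q) \<in> A" for p q
  proof (cases "p \<in> P \<and> q \<in> P")
    case True
    then show ?thesis using that by (auto simp: \<pi>_def)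
  next
    case False
    then have "p \<in> Q" "q \<in> Q" using that assms(2) by auto
    then have "\<pi> p = x" "\<pi> q = x" using assms(1) by (auto simp: \<pi>_def)
    then show ?thesis by simp
  qed
  then have "(\<pi> u, \<pi> v) \<in> (A \<inter> P \<times> P)\<^sup>*" using rtrancl_retract[OF assms(5)] by blast
  then show ?thesis using assms by (simp add: \<pi>_def)
qed

lemma (in dicycle) cycle_connected:
  assumes "x \<notin> C" "u \<in> C" "v \<in> C"
  shows "(u, v) \<in> (A \<inter> (V - {x}) \<times> (V - {x}))\<^sup>*"
proof -
  let ?B = "A \<inter> (V - {x}) \<times> (V - {x})"
  have s: "(g i, g (i + 1)) \<in> ?B" for i
  proof -
    have "g i \<noteq> x" "g (i + 1) \<noteq> x" using assms(1) by (auto simp: C_def)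
    then show ?thesis using step[of i] arcs by blast
  qed
  have r: "(g i, g (i + int k)) \<in> ?B\<^sup>*" for i k
  proof (induction k)
    case (Suc k)
    have "(g (i + int k), g (i + int (Suc k))) \<in> ?B" using s[of "i + int k"] by (simp add: add.commute add.left_commute)
    with Suc show ?case by (rule rtrancl.rtrancl_into_rtrancl)
  qed simp
  obtain i where u: "u = g i" using assms by (auto simp: C_def)
  obtain j where "i \<le> j" "v = g j" using C_window assms by blast
  then show ?thesis using r[of i "nat (j - i)"] u by simp
qed

theorem theta_free_4_colourable:
  assumes "finite V" "A \<subseteq> V \<times> V" "\<And>v. (v, v) \<notin> A" "\<And>u v. u \<in> V \<Longrightarrow> v \<in> V \<Longrightarrow> (u, v) \<in> A\<^sup>*"
    and "theta_free A"
  shows "\<exists>c. colouring 4 V A c"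
  using assms
proof (induction "card V" arbitrary: V A rule: less_induct)
  case less
  note V = less.prems(1,2) and loopless = less.prems(3) and strong = less.prems(4) and tf = less.prems(5)
  have smaller: "\<exists>c. colouring 4 U (A \<inter> U \<times> U) c"
    if "U \<subset> V" and "\<And>u v. u \<in> U \<Longrightarrow> v \<in> U \<Longrightarrow> (u, v) \<in> (A \<inter> U \<times> U)\<^sup>*" for U
  proof (rule less.hyps)
    show "card U < card V" using that V by (intro psubset_card_mono)
    show "finite U" using that V by (auto intro: finite_subset)
    show "theta_free (A \<inter> U \<times> U)" using tf by (rule theta_free_mono) auto
  qed (use that loopless in auto)
  show ?case
  proof (cases "\<exists>e xs. cycle_through A e xs \<and> 5 \<le> length xs")
    case False
    then have "length xs \<le> 4" if "cycle_through A e xs" for e xs using that by fastforce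
    then show ?thesis using strong_colourable_if_cycles_short[OF V loopless strong] by force
  next
    case True
    show ?thesis
    proof (cases "\<exists>x. cut_vertex V A x")
      case True
      then obtain x P Q where PQ: "V = P \<union> Q" "P \<inter> Q = {x}" "P \<noteq> {x}" "Q \<noteq> {x}" "A \<subseteq> P \<times> P \<union> Q \<times> Q"
        unfolding cut_vertex_def by blast
      have "P \<subset> V" "Q \<subset> V" using PQ by auto
      moreover have "(u, v) \<in> (A \<inter> P \<times> P)\<^sup>*" if "u \<in> P" "v \<in> P" for u v
        by (rule cut_vertex_strong[of P Q x]) (use PQ strong that in auto)
      moreover have "(u, v) \<in> (A \<inter> Q \<times> Q)\<^sup>*" if "u \<in> Q" "v \<in> Q" for u v
        by (rule cut_vertex_strong[of Q P x]) (use PQ strong that in auto)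
      ultimately obtain c d where "colouring 4 P (A \<inter> P \<times> P) c" "colouring 4 Q (A \<inter> Q \<times> Q) d"
        using smaller[of P] smaller[of Q] by blast
      then show ?thesis using cut_vertex_colouring PQ by metis
    next
      case no_cut: False
      define cyc where "cyc p \<longleftrightarrow> cycle_through A (fst p) (snd p)" for p :: "('a \<times> 'a) \<times> 'a list"
      obtain e0 xs0 where xs0: "cyc (e0, xs0)" "5 \<le> length xs0" using True by (auto simp: cyc_def)
      have "\<forall>p. cyc p \<longrightarrow> length (snd p) < Suc (card V)"
        using cycle_length_le_card[OF V] by (fastforce simp: cyc_def)
      from ex_has_greatest_nat[of cyc, OF xs0(1) this]
      obtain p where p: "cyc p" "\<And>q. cyc q \<Longrightarrow> length (snd q) \<le> length (snd p)" by blast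
      define zs where "zs = snd p"
      define g where "g i = zs ! nat (i mod int (length zs))" for i
      have "5 \<le> length zs" using p(2)[OF xs0(1)] xs0(2) by (simp add: zs_def)
      moreover have "cycle_through A (fst p) zs" using p(1) by (simp add: cyc_def zs_def)
      ultimately have "dicycle V A (int (length zs)) g"
        unfolding g_def by (intro dicycleI) (use V loopless tf in auto)
      then interpret longest_dicycle V A "int (length zs)" g
      proof (rule longest_dicycle.intro, unfold_locales)
        show "int (length xs) \<le> int (length zs)" if "cycle_through A e xs" for e xs
          using p(2)[of "(e, xs)"] that by (simp add: cyc_def zs_def)
      qed (use strong no_cut in auto)
      show ?thesis
      proof (cases "V = C")
        case True
        then show ?thesis by (rule hamiltonian_4_colourable)
      next
        case False
        then obtain x i where x: "x \<in> V - C" and ix: "(g i, x) \<in> A" "(x, g (i + 2)) \<in> A"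
          using exists_short_ear by blast
        let ?U = "V - {x}"
        have xC: "x \<notin> C" using x by simp
        \<comment> \<open>In walks, \<open>x\<close> is replaced by the bypassed vertex, with detours along the cycle where arcs are missing.\<close>
        define \<pi> where "\<pi> w = (if w = x then g (i + 1) else w)" for w
        have \<pi>: "(\<pi> s, \<pi> t) \<in> (A \<inter> ?U \<times> ?U)\<^sup>*" if st: "(s, t) \<in> A" for s t
        proof (cases "s = x \<or> t = x")
          case True
          have "s \<noteq> t" using st loopless by auto
          then have "\<pi> s \<in> C" "\<pi> t \<in> C"
            using True st short_ear_neighbours[OF x ix, of s] short_ear_neighbours[OF x ix, of t]
            by (auto simp: \<pi>_def)
          then show ?thesis using cycle_connected[OF xC] by blast
        next
          case False
          then show ?thesis using st V(2) by (auto simp: \<pi>_def)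
        qed
        have "(s, t) \<in> (A \<inter> ?U \<times> ?U)\<^sup>*" if "s \<in> ?U" "t \<in> ?U" for s t
          using rtrancl_retract[OF strong[of s t], of \<pi> "A \<inter> ?U \<times> ?U"] \<pi> that by (simp add: \<pi>_def)
        then obtain c where c: "colouring 4 ?U (A \<inter> ?U \<times> ?U) c"
          using smaller[of ?U] x by blast
        have "\<exists>t<4. t \<noteq> c (g i) \<and> t \<noteq> c (g (i + 2))" by presburger
        then obtain t where t: "t < 4" "t \<noteq> c (g i)" "t \<noteq> c (g (i + 2))" by blast
        have "(c(x := t)) u \<noteq> (c(x := t)) v" if uv: "(u, v) \<in> A" for u v
        proof -
          have "u \<noteq> v" "u \<in> V" "v \<in> V" using uv V loopless by auto
          then show ?thesis
            using uv c t short_ear_neighbours[OF x ix, of u] short_ear_neighbours[OF x ix, of v]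
            by (auto simp: colouring_def)
        qed
        moreover have "(c(x := t)) v < 4" if "v \<in> V" for v
          using c t that by (auto simp: colouring_def)
        ultimately show ?thesis by (intro exI[of _ "c(x := t)"] colouringI)
      qed
    qed
  qed
qed

section \<open>Subdivisions of the two-block cycle\<close>

lemma pawalk_verts_vwalk_arcs: "xs \<noteq> [] \<Longrightarrow> pawalk_verts (hd xs) (vwalk_arcs xs) = xs"
  by (induction xs rule: vwalk_arcs.induct) auto

lemma pcas_vwalk_arcs: "xs \<noteq> [] \<Longrightarrow> pcas (hd xs) (vwalk_arcs xs) (last xs)"
  by (induction xs rule: vwalk_arcs.induct) auto

lemma inner_verts_vwalk_arcs:
  "pre_digraph.inner_verts (with_proj H) (vwalk_arcs xs) = tl (butlast xs)"
proof -
  have "map fst (vwalk_arcs xs) = butlast xs" by (induction xs rule: vwalk_arcs.induct) auto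
  then show ?thesis by (simp add: inner_verts_with_proj_def)
qed

lemma vwalk_arcs_apath:
  assumes "xs \<noteq> []" "distinct xs" "set xs \<subseteq> pverts H" "set (vwalk_arcs xs) \<subseteq> parcs H"
  shows "pre_digraph.apath (with_proj H) (hd xs) (vwalk_arcs xs) (last xs)"
  using assms pawalk_verts_vwalk_arcs[of xs] pcas_vwalk_arcs[of xs]
  by (auto simp: pre_digraph.apath_def pre_digraph.awalk_def cas_with_proj_eq awalk_verts_with_proj_eq)

lemma dipath_arcs: "dipath A xs \<Longrightarrow> set (vwalk_arcs xs) \<subseteq> A"
  by (induction xs rule: vwalk_arcs.induct) auto

lemma set_vwalk_arcs: "set (vwalk_arcs xs) \<subseteq> set xs \<times> set xs"
  by (induction xs rule: vwalk_arcs.induct) auto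

lemma parcs_two_block_cycle_2_3:
  "pverts (two_block_cycle 2 3) = {0, 1, 2, 3, 4}"
  "parcs (two_block_cycle 2 3) = {(0, 1), (1, 2), (0, 3), (3, 4), (4, 2)}"
  by (auto simp: two_block_cycle_def upt_rec numeral_2_eq_2[symmetric])

text \<open>
The branch vertices \<open>0, \<dots>, 4\<close> of \<open>C(2,3)\<close> become \<open>u, p, v, q, r\<close>. The arcs into \<open>2\<close>, the last ones of both
blocks, take up the remaining lengths of the two paths; the other arcs are not subdivided.
\<close>

lemma theta_subdivision:
  assumes D: "pair_digraph D"
    and X: "dipath (parcs D) (u # p # ps @ [v])" and Y: "dipath (parcs D) (u # q # r # qs @ [v])"
    and disj: "set (p # ps) \<inter> set (q # r # qs) = {}"
  shows "\<exists>H. subgraph (with_proj H) (with_proj D) \<and> is_subdivision_of H (two_block_cycle 2 3)"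
proof -
  interpret D: pair_digraph D by (rule D)
  define X' Y' where "X' = u # p # ps @ [v]" and "Y' = u # q # r # qs @ [v]"
  define H where "H = \<lparr>pverts = set X' \<union> set Y', parcs = set (vwalk_arcs X') \<union> set (vwalk_arcs Y')\<rparr>"
  define \<phi> where "\<phi> i = [u, p, v, q, r] ! i" for i :: nat
  define L where "L a = (if a = (1, 2) then p # ps @ [v] else if a = (4, 2) then r # qs @ [v]
    else [\<phi> (fst a), \<phi> (snd a)])" for a :: "nat \<times> nat"
  have HD: "parcs H \<subseteq> parcs D"
    using dipath_arcs[OF X] dipath_arcs[OF Y] by (simp add: H_def X'_def Y'_def)
  have u: "u \<in> pverts D" using X D.in_arcsD1 by auto
  have "parcs D \<subseteq> pverts D \<times> pverts D" using D.in_arcsD1 D.in_arcsD2 by auto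
  then have "pverts H \<subseteq> pverts D"
    using dipath_subset[OF X, of "pverts D"] dipath_subset[OF Y, of "pverts D"] u
    unfolding H_def X'_def Y'_def by auto
  moreover have "wf_digraph (with_proj H)"
    using set_vwalk_arcs[of X'] set_vwalk_arcs[of Y'] by unfold_locales (auto simp: H_def)
  moreover have "wf_digraph (with_proj D)" by unfold_locales
  ultimately have "subgraph (with_proj H) (with_proj D)"
    using HD by (auto simp: subgraph_def compatible_def)
  moreover have "is_subdivision_of H (two_block_cycle 2 3)"
    unfolding is_subdivision_of_def
  proof (intro exI conjI)
    have d: "distinct X'" "distinct Y'" using X Y by (auto simp: dipath_def X'_def Y'_def)
    show "inj_on \<phi> (pverts (two_block_cycle 2 3))"
      using d disj by (auto simp: parcs_two_block_cycle_2_3 \<phi>_def X'_def Y'_def)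
    have L: "pre_digraph.apath (with_proj H) (hd (L a)) (vwalk_arcs (L a)) (last (L a))"
      if "a \<in> parcs (two_block_cycle 2 3)" for a
      using that d by (intro vwalk_arcs_apath)
        (auto simp: parcs_two_block_cycle_2_3 L_def \<phi>_def H_def X'_def Y'_def)
    have ends: "hd (L a) = \<phi> (fst a)" "last (L a) = \<phi> (snd a)" "1 \<le> length (vwalk_arcs (L a))"
      if "a \<in> parcs (two_block_cycle 2 3)" for a
      using that by (auto simp: parcs_two_block_cycle_2_3 L_def \<phi>_def neq_Nil_conv)
    have inner: "set (tl (butlast (L a))) \<inter> \<phi> ` pverts (two_block_cycle 2 3) = {}"
      if "a \<in> parcs (two_block_cycle 2 3)" for a
      using that d disj by (auto simp: parcs_two_block_cycle_2_3 L_def \<phi>_def X'_def Y'_def)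
    show "\<forall>a\<in>parcs (two_block_cycle 2 3).
       pre_digraph.apath (with_proj H) (\<phi> (fst a)) (vwalk_arcs (L a)) (\<phi> (snd a)) \<and>
       1 \<le> length (vwalk_arcs (L a)) \<and>
       set (pre_digraph.inner_verts (with_proj H) (vwalk_arcs (L a))) \<inter> \<phi> ` pverts (two_block_cycle 2 3) = {}"
      using L ends inner by (simp add: inner_verts_vwalk_arcs)
    show "\<forall>a\<in>parcs (two_block_cycle 2 3). \<forall>b\<in>parcs (two_block_cycle 2 3). a \<noteq> b \<longrightarrow>
       set (pre_digraph.inner_verts (with_proj H) (vwalk_arcs (L a))) \<inter>
       set (pre_digraph.inner_verts (with_proj H) (vwalk_arcs (L b))) = {}"
      using disj by (auto simp: parcs_two_block_cycle_2_3 inner_verts_vwalk_arcs L_def)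
    show "pverts H = \<phi> ` pverts (two_block_cycle 2 3) \<union>
       (\<Union>a\<in>parcs (two_block_cycle 2 3). set (pre_digraph.inner_verts (with_proj H) (vwalk_arcs (L a))))"
      by (auto simp: parcs_two_block_cycle_2_3 inner_verts_vwalk_arcs L_def \<phi>_def H_def X'_def Y'_def)
    show "parcs H = (\<Union>a\<in>parcs (two_block_cycle 2 3). set (vwalk_arcs (L a)))"
      by (auto simp: parcs_two_block_cycle_2_3 L_def \<phi>_def H_def X'_def Y'_def)
  qed
  ultimately show ?thesis by blast
qed

lemma S_Forb_theta_free:
  assumes "D \<in> S_Forb (two_block_cycle 2 3)"
  shows "theta_free (parcs D)"
  unfolding theta_free_def
proof clarify
  fix u v ps qs
  assume X: "dipath (parcs D) (u # ps @ [v])" and Y: "dipath (parcs D) (u # qs @ [v])"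
    and disj: "set ps \<inter> set qs = {}" and len: "1 \<le> length ps" "2 \<le> length qs"
  obtain p ps' where ps: "ps = p # ps'" using len by (cases ps) auto
  obtain q r qs' where qs: "qs = q # r # qs'" using len by (cases qs rule: remdups_adj.cases) auto
  show False using theta_subdivision[of D u p ps' v q r qs'] assms X Y disj ps qs
    by (auto simp: S_Forb_def)
qed

lemma proper_colouring_mk_symmetric:
  "proper_colouring (mk_symmetric (with_proj D)) k c \<longleftrightarrow> colouring k (pverts D) (parcs D) c"
  by (fastforce simp: proper_colouring_def colouring_def mk_symmetric_def)

lemma chromatic_number_le: "colouring k (pverts D) (parcs D) c \<Longrightarrow> chromatic_number D \<le> k"
  unfolding chromatic_number_def graph_chromatic_number_def proper_colouring_mk_symmetric
  by (rule Least_le) blast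

lemma strong_S_Forb_chromatic_number_le:
  assumes "D \<in> S_Forb (two_block_cycle 2 3) \<inter> strong_digraphs"
  shows "chromatic_number D \<le> 4"
proof -
  interpret D: pair_digraph D using assms by (simp add: strong_digraphs_def)
  have "(u, v) \<in> (parcs D)\<^sup>*" if "u \<in> pverts D" "v \<in> pverts D" for u v
    using that assms rtrancl_on_sub_rtrancl[of "pverts D" "parcs D"]
    by (auto simp: strong_digraphs_def strongly_connected_def reachable_def)
  then have "\<exists>c. colouring 4 (pverts D) (parcs D) c"
    using assms S_Forb_theta_free[of D] D.pair_finite_verts D.in_arcsD1 D.in_arcsD2 D.pair_no_loops
    by (intro theta_free_4_colourable) force+
  then show ?thesis using chromatic_number_le by blast
qed

definition complete_pair_digraph :: "'a set \<Rightarrow> 'a pair_pre_digraph" where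
  "complete_pair_digraph U = \<lparr>pverts = U, parcs = {(u, v). u \<in> U \<and> v \<in> U \<and> u \<noteq> v}\<rparr>"

lemma chromatic_number_complete:
  assumes "finite U"
  shows "card U \<le> chromatic_number (complete_pair_digraph U)"
proof -
  let ?K = "complete_pair_digraph U"
  obtain c0 :: "'a \<Rightarrow> nat" where c0: "inj_on c0 U" "c0 ` U = {..<card U}"
    using ex_bij_betw_finite_nat[OF assms] by (auto simp: bij_betw_def lessThan_atLeast0)
  then have "colouring (card U) (pverts ?K) (parcs ?K) c0"
    by (auto simp: colouring_def complete_pair_digraph_def inj_on_def)
  then have "\<exists>k c. colouring k (pverts ?K) (parcs ?K) c" by blast
  then obtain c where c: "colouring (chromatic_number ?K) (pverts ?K) (parcs ?K) c"
    unfolding chromatic_number_def graph_chromatic_number_def proper_colouring_mk_symmetric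
    using LeastI_ex[of "\<lambda>k. \<exists>c. colouring k (pverts ?K) (parcs ?K) c"] by blast
  then have "inj_on c U" "c ` U \<subseteq> {..<chromatic_number ?K}"
    by (auto simp: colouring_def complete_pair_digraph_def inj_on_def)
  then show ?thesis using card_inj_on_le[of c U "{..<chromatic_number ?K}"] by simp
qed

text \<open>
The five branch vertices of a subdivision do not fit into four vertices.
\<close>

lemma complete_in_S_Forb_strong:
  assumes U: "finite U" "card U = 4"
  shows "complete_pair_digraph U \<in> S_Forb (two_block_cycle 2 3) \<inter> strong_digraphs"
proof -
  let ?K = "complete_pair_digraph U"
  have K: "pair_digraph ?K"
    using U by unfold_locales
      (auto simp: complete_pair_digraph_def intro: finite_subset[of _ "U \<times> U"])
  have "u \<rightarrow>\<^sup>*\<^bsub>with_proj ?K\<^esub> v" if "u \<in> U" "v \<in> U" for u v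
    using that by (cases "u = v")
      (auto simp: reachable_def complete_pair_digraph_def intro: rtrancl_on_into_rtrancl_on)
  then have "strongly_connected (with_proj ?K)"
    using U by (auto simp: strongly_connected_def complete_pair_digraph_def)
  moreover have False if sub: "subgraph (with_proj H) (with_proj ?K)"
    and subdiv: "is_subdivision_of H (two_block_cycle 2 3)" for H
  proof -
    obtain \<phi> where "inj_on \<phi> {..<5 :: nat}" "\<phi> ` {..<5} \<subseteq> pverts H"
      using subdiv unfolding is_subdivision_of_def by (auto simp: two_block_cycle_def)
    moreover have "pverts H \<subseteq> U" using sub by (auto simp: subgraph_def complete_pair_digraph_def)
    ultimately have "card {..<5 :: nat} \<le> card U" using U by (intro card_inj_on_le) auto
    then show False using U by simp
  qed
  ultimately show ?thesis using K by (auto simp: S_Forb_def strong_digraphs_def)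
qed

theorem corollary42:
  shows "class_chromatic_number
           (S_Forb (two_block_cycle 2 3) \<inter> strong_digraphs :: 'a::infinite pair_pre_digraph set) = 4"
proof -
  let ?D = "S_Forb (two_block_cycle 2 3) \<inter> strong_digraphs :: 'a pair_pre_digraph set"
  obtain U :: "'a set" where U: "finite U" "card U = 4"
    using infinite_arbitrarily_large[OF infinite_UNIV, of 4] by blast
  have "4 \<le> m" if "\<forall>D\<in>?D. chromatic_number D \<le> m" for m
    using that complete_in_S_Forb_strong[OF U] chromatic_number_complete[OF U(1)] U(2)
    by (metis order_trans)
  then have "4 \<le> enat m" if "\<forall>D\<in>?D. chromatic_number D \<le> m" for m
    using that by (metis enat_ord_simps(1) numeral_eq_enat)
  moreover have "4 \<in> {enat m |m. \<forall>D\<in>?D. chromatic_number D \<le> m}"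
    using strong_S_Forb_chromatic_number_le by (auto simp: numeral_eq_enat)
  ultimately show ?thesis
    unfolding class_chromatic_number_def by (intro antisym Inf_lower Inf_greatest) auto
qed

end
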